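(* Let $n,N\ge1$ be integers and let $a_\gamma\in\mathbb{R}$ ($0\le|\gamma|\le N-1$) be given with $a_0=1$. Let $\mathcal{A}^{-1}=\{\mathcal{A}^{(-1)}_{\alpha\beta}\}$ be the inverse of the triangular matrix $\mathcal{A}$ built from the $a_\gamma$ (defined in the context). Suppose that $\eta\in C^{N-1}(\mathbb{R}^n)$ satisfies $$|\eta(x)|\le A(1+|x|)^{-K},\quad x\in\mathbb{R}^n,\qquad \text{for some constants } A \text{ and } K>N+n,$$ $$\int_{\mathbb{R}^n}|x|^{N-1}|\partial^\alpha\eta(x)|\,dx<\infty,\qquad 0\le|\alpha|\le N-1,$$ and $\mathcal{F}\eta(0)\ne0$. Then the function $$\mathcal{H}(x)=\sum_{|\beta|=0}^{N-1}\ \sum_{\alpha\le\beta}\mathcal{A}^{(-1)}_{0\alpha}(-1)^{|\alpha|}\,\frac{\partial^{\beta-\alpha}(\mathcal{F}\eta)^{-1}(0)}{(\beta-\alpha)!\,(2\pi i)^{|\beta-\alpha|}}\,\partial^\beta\eta(x)$$ satisfies the conditions $$\int_{\mathbb{R}^n}\mathcal{H}(x)\,dx=1,\qquad \sum_{\alpha\le\beta}\frac{a_{\beta-\alpha}}{\alpha!}\int_{\mathbb{R}^n}x^\alpha\mathcal{H}(x)\,dx=0\quad\text{for all }\beta\text{ with }1\le|\beta|\le N-1 .$$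
   Context: Greek letters $\alpha,\beta,\gamma$ denote multi-indices in $\mathbb{Z}_{\ge0}^n$; $\alpha\le\beta$ is meant componentwise. $\mathcal{A}=\{\mathcal{A}_{\alpha\beta}\}$ is the square matrix indexed by multi-indices with $0\le|\alpha|,|\beta|\le N-1$, with $\mathcal{A}_{\alpha\beta}=a_{\beta-\alpha}$ if $\alpha\le\beta$ and $\mathcal{A}_{\alpha\beta}=0$ otherwise; it has determinant $1$, hence is invertible. The Fourier transform is $\mathcal{F}\eta(\lambda)=\int_{\mathbb{R}^n}\eta(x)e^{-2\pi i\langle x,\lambda\rangle}\,dx$. The notation $\partial^{\gamma}(\mathcal{F}\eta)^{-1}(0)$ means the derivative $\partial^\gamma$ of the function $\lambda\mapsto 1/\mathcal{F}\eta(\lambda)$ evaluated at $\lambda=0$. *)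

theory Defs
  imports "HOL-Analysis.Analysis"
begin

text \<open>
  Points of n-dimensional space are \<open>x :: real ^ 'n\<close> with \<open>n = CARD('n) \<ge> 1\<close>; multi-indices are
  functions \<open>'n \<Rightarrow> nat\<close>.  The order \<open>\<le>\<close> and the difference on them are the pointwise ones of the
  function type; the difference truncates, so \<open>\<beta> - \<alpha>\<close> is used only under \<open>\<alpha> \<le> \<beta>\<close>.
\<close>

type_synonym 'n multi_index = "'n \<Rightarrow> nat"

definition mi_abs :: "'n::finite multi_index \<Rightarrow> nat" where
  "mi_abs \<alpha> = (\<Sum>i\<in>UNIV. \<alpha> i)"

definition mi_fact :: "'n::finite multi_index \<Rightarrow> nat" where
  "mi_fact \<alpha> = (\<Prod>i\<in>UNIV. fact (\<alpha> i))"

definition mi_power :: "real ^ 'n::finite \<Rightarrow> 'n multi_index \<Rightarrow> real" where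
  "mi_power x \<alpha> = (\<Prod>i\<in>UNIV. (x $ i) ^ \<alpha> i)"

definition multi_indices :: "nat \<Rightarrow> 'n::finite multi_index set" where
  "multi_indices m = {\<alpha>. mi_abs \<alpha> \<le> m}"

definition partial_deriv :: "'n::finite \<Rightarrow> (real ^ 'n \<Rightarrow> complex) \<Rightarrow> real ^ 'n \<Rightarrow> complex" where
  "partial_deriv i f x = vector_derivative (\<lambda>t::real. f (x + t *\<^sub>R axis i 1)) (at 0)"

text \<open>
  An arbitrary but fixed enumeration of the coordinates.  It fixes the order in which
  \<open>mi_deriv\<close> takes partial derivatives, which is immaterial for functions that are k times
  continuously differentiable near the point considered and multi-indices of length at most k.
\<close>

definition coords :: "'n::finite list" where
  "coords = (SOME l. distinct l \<and> set l = UNIV)"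

definition mi_deriv :: "'n::finite multi_index \<Rightarrow> (real ^ 'n \<Rightarrow> complex) \<Rightarrow> real ^ 'n \<Rightarrow> complex" where
  "mi_deriv \<alpha> f = foldr (\<lambda>i. partial_deriv i ^^ \<alpha> i) coords f"

primrec C_times :: "nat \<Rightarrow> (real ^ 'n::finite \<Rightarrow> complex) \<Rightarrow> bool" where
  "C_times 0 f \<longleftrightarrow> continuous_on UNIV f"
| "C_times (Suc k) f \<longleftrightarrow> continuous_on UNIV f \<and>
     (\<forall>i. (\<forall>x. (\<lambda>t::real. f (x + t *\<^sub>R axis i 1)) differentiable (at 0)) \<and>
          C_times k (partial_deriv i f))"

definition fourier :: "(real ^ 'n::finite \<Rightarrow> complex) \<Rightarrow> real ^ 'n \<Rightarrow> complex" where
  "fourier f \<xi> = (LINT x|lborel. f x * exp (- 2 * of_real pi * \<i> * of_real (x \<bullet> \<xi>)))"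

text \<open>
  Inverse of a square matrix whose rows and columns are indexed by a finite set \<open>I\<close>: the analogue
  of \<open>matrix_inv\<close>, which needs the index set to be a type.  If an inverse exists, its entries with
  indices in \<open>I\<close> are uniquely determined.
\<close>

definition matrix_inv_on :: "'i set \<Rightarrow> ('i \<Rightarrow> 'i \<Rightarrow> real) \<Rightarrow> 'i \<Rightarrow> 'i \<Rightarrow> real" where
  "matrix_inv_on I A = (SOME B. \<forall>\<alpha>\<in>I. \<forall>\<beta>\<in>I.
     (\<Sum>\<gamma>\<in>I. A \<alpha> \<gamma> * B \<gamma> \<beta>) = of_bool (\<alpha> = \<beta>) \<and>
     (\<Sum>\<gamma>\<in>I. B \<alpha> \<gamma> * A \<gamma> \<beta>) = of_bool (\<alpha> = \<beta>))"

definition tri_matrix ::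
  "('n::finite multi_index \<Rightarrow> real) \<Rightarrow> 'n multi_index \<Rightarrow> 'n multi_index \<Rightarrow> real" where
  "tri_matrix a \<alpha> \<beta> = (if \<alpha> \<le> \<beta> then a (\<beta> - \<alpha>) else 0)"

definition H_fun ::
  "nat \<Rightarrow> ('n::finite multi_index \<Rightarrow> real) \<Rightarrow> (real ^ 'n \<Rightarrow> complex) \<Rightarrow> real ^ 'n \<Rightarrow> complex" where
  "H_fun N a \<eta> x =
     (\<Sum>\<beta>\<in>multi_indices (N - 1). \<Sum>\<alpha>\<in>{\<alpha>. \<alpha> \<le> \<beta>}.
        of_real (matrix_inv_on (multi_indices (N - 1)) (tri_matrix a) (\<lambda>_. 0) \<alpha>)
        * (- 1) ^ mi_abs \<alpha>
        * (mi_deriv (\<beta> - \<alpha>) (\<lambda>\<xi>. 1 / fourier \<eta> \<xi>) 0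
           / (of_nat (mi_fact (\<beta> - \<alpha>)) * (2 * of_real pi * \<i>) ^ mi_abs (\<beta> - \<alpha>)))
        * mi_deriv \<beta> \<eta> x)"

end

theory Submission
  imports Defs
begin

text \<open>
  For a function \<open>g\<close> write \<open>E g \<gamma>\<close> for the normalised moment \<open>\<integral> x\<^sup>\<gamma> g / \<gamma>!\<close>, and let \<open>c = -2\<pi>\<i>\<close>.
  The proof is a computation in the commutative ring of sequences indexed by multi-indices, with
  the convolution \<open>(f * g) \<beta> = \<Sum>\<alpha>\<le>\<beta>. f \<alpha> g (\<beta> - \<alpha>)\<close> as product (\<open>mi_conv\<close>): a triangular matrix
  with entries \<open>a (\<beta> - \<alpha>)\<close> acts on row vectors as convolution with \<open>a\<close>, and the other ingredients
  of \<open>H_fun\<close> are convolutions as well.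

  Differentiating under the integral sign gives \<open>\<partial>\<^sup>\<gamma>(\<F>\<eta>)(0) / \<gamma>! = c\<^bsup>|\<gamma>|\<^esup> E \<eta> \<gamma>\<close>
  (\<open>taylor_coeff_fourier\<close>).  The Leibniz rule says that Taylor coefficients of a product are the
  convolution of those of the factors (\<open>taylor_coeff_mult\<close>), so
  \<open>d \<gamma> = \<partial>\<^sup>\<gamma>(1/\<F>\<eta>)(0) / (\<gamma>! c\<^bsup>|\<gamma>|\<^esup>)\<close> is the convolution inverse of \<open>E \<eta>\<close> up to length \<open>N - 1\<close>.
  Integration by parts gives \<open>E (\<partial>\<^sup>\<beta>\<eta>) \<alpha> = (-1)\<^bsup>|\<beta>|\<^esup> E \<eta> (\<alpha> - \<beta>)\<close> for \<open>\<beta> \<le> \<alpha>\<close>, and \<open>0\<close> otherwise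
  (\<open>normalised_moment_mi_deriv\<close>).

  Let \<open>b\<close> be the row with index \<open>0\<close> of the inverse matrix.  The signs in \<open>H_fun\<close> are such that the
  coefficient of \<open>\<partial>\<^sup>\<beta>\<eta>\<close> is \<open>(-1)\<^bsup>|\<beta>|\<^esup> (b * d) \<beta>\<close>.  Hence, up to length \<open>N - 1\<close>,
  \<open>E (H_fun) = (b * d) * E \<eta> = b\<close> (\<open>normalised_moment_H_fun\<close>), and the sums in the conclusion are the
  values of \<open>b * a\<close>, which is the unit sequence there because \<open>b\<close> comes from the inverse matrix.
\<close>

section \<open>Multi-indices and their convolution algebra\<close>

definition mi_inc :: "'n \<Rightarrow> 'n multi_index \<Rightarrow> 'n multi_index" where
  "mi_inc i \<beta> = \<beta>(i := Suc (\<beta> i))"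

lemma mi_inc_apply: "mi_inc i \<beta> j = (if j = i then Suc (\<beta> j) else \<beta> j)"
  by (simp add: mi_inc_def)

lemma le_mi_inc: "\<beta> \<le> mi_inc i \<beta>"
  by (simp add: le_fun_def mi_inc_apply)

lemma mi_inc_mono: "\<alpha> \<le> \<beta> \<Longrightarrow> mi_inc i \<alpha> \<le> mi_inc i \<beta>"
  by (simp add: le_fun_def mi_inc_apply)

lemma mi_inc_diff: "\<gamma> \<le> \<beta> \<Longrightarrow> mi_inc i \<beta> - \<gamma> = mi_inc i (\<beta> - \<gamma>)"
  by (auto simp: fun_eq_iff mi_inc_apply le_fun_def Suc_diff_le)

lemma mi_inc_diff_mi_inc: "mi_inc i \<beta> - mi_inc i \<gamma> = \<beta> - \<gamma>"
  by (auto simp: fun_eq_iff mi_inc_apply)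

lemma mi_diff_self: "(\<alpha>::'n multi_index) - \<alpha> = (\<lambda>_. 0)"
  by (simp add: fun_eq_iff)

lemma mi_diff_zero: "(\<alpha>::'n multi_index) - (\<lambda>_. 0) = \<alpha>"
  by (simp add: fun_eq_iff)

lemma mi_diff_le: "(\<alpha>::'n multi_index) - \<gamma> \<le> \<alpha>"
  by (simp add: le_fun_def)

lemma mi_diff_diff: "\<alpha> \<le> \<beta> \<Longrightarrow> \<beta> - (\<beta> - \<alpha>) = (\<alpha>::'n multi_index)"
  by (simp add: fun_eq_iff le_fun_def)

lemma mi_add_simps:
  fixes \<alpha> \<beta> \<sigma> \<delta> :: "'n multi_index"
  shows "\<sigma> \<le> \<beta> \<Longrightarrow> \<delta> \<le> \<beta> - \<sigma> \<Longrightarrow> (\<lambda>i. \<sigma> i + \<delta> i) \<le> \<beta>"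
    and "\<sigma> \<le> (\<lambda>i. \<sigma> i + \<delta> i)"
    and "(\<lambda>i. \<sigma> i + \<delta> i) - \<sigma> = \<delta>"
    and "\<sigma> \<le> \<alpha> \<Longrightarrow> (\<lambda>i. \<sigma> i + (\<alpha> - \<sigma>) i) = \<alpha>"
    and "\<sigma> \<le> \<alpha> \<Longrightarrow> (\<lambda>i. \<sigma> i + (\<alpha> i - \<sigma> i)) = \<alpha>"
    and "\<sigma> \<le> \<alpha> \<Longrightarrow> \<beta> - \<sigma> - (\<alpha> - \<sigma>) = \<beta> - \<alpha>"
    and "\<beta> - (\<lambda>i. \<sigma> i + \<delta> i) = \<beta> - \<sigma> - \<delta>"
    and "\<alpha> \<le> \<beta> \<Longrightarrow> \<alpha> - \<sigma> \<le> \<beta> - \<sigma>"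
  by (auto simp: le_fun_def fun_eq_iff diff_le_mono le_diff_conv2 add.commute)

lemma mi_zero_le: "(\<lambda>_. 0) \<le> (\<alpha>::'n multi_index)"
  by (simp add: le_fun_def)

lemma mi_le_zero: "{\<alpha>. \<alpha> \<le> (\<lambda>_. 0)} = {(\<lambda>_. 0) :: 'n multi_index}"
  by (auto simp: le_fun_def)

lemma mi_abs_zero: "mi_abs (\<lambda>_. 0) = 0"
  by (simp add: mi_abs_def)

lemma mi_abs_inc: "mi_abs (mi_inc i \<beta>) = Suc (mi_abs \<beta>)"
  by (simp add: mi_abs_def sum.remove[of UNIV i] mi_inc_apply)

lemma mi_abs_mono: "\<alpha> \<le> \<beta> \<Longrightarrow> mi_abs \<alpha> \<le> mi_abs \<beta>"
  by (simp add: mi_abs_def le_fun_def sum_mono)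

lemma mi_abs_diff: "\<alpha> \<le> \<beta> \<Longrightarrow> mi_abs \<alpha> + mi_abs (\<beta> - \<alpha>) = mi_abs \<beta>"
  by (simp add: mi_abs_def le_fun_def flip: sum.distrib)

lemma mi_abs_strict_mono:
  assumes "\<alpha> \<le> \<beta>" and "\<alpha> \<noteq> \<beta>"
  shows "mi_abs \<alpha> < mi_abs \<beta>"
proof -
  obtain i where "\<alpha> i \<noteq> \<beta> i"
    using assms(2) by blast
  then have "\<alpha> i < \<beta> i"
    using assms(1) by (simp add: le_fun_def order_less_le)
  with assms(1) show ?thesis
    unfolding mi_abs_def by (intro sum_strict_mono_ex1) (auto simp: le_fun_def)
qed

lemma mi_fact_zero: "mi_fact (\<lambda>_. 0) = 1"
  by (simp add: mi_fact_def)

lemma mi_fact_inc: "mi_fact (mi_inc i \<beta>) = Suc (\<beta> i) * mi_fact \<beta>"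
  by (simp add: mi_fact_def prod.remove[of UNIV i] mi_inc_apply algebra_simps)

lemma mi_power_zero: "mi_power x (\<lambda>_. 0) = 1"
  by (simp add: mi_power_def)

lemma mi_power_inc: "mi_power x (mi_inc i \<beta>) = x $ i * mi_power x \<beta>"
  by (simp add: mi_power_def prod.remove[of UNIV i] mi_inc_apply)

lemma finite_mi_le: "finite {\<alpha>. \<alpha> \<le> (\<beta>::'n::finite multi_index)}"
proof -
  have "{\<alpha>. \<alpha> \<le> \<beta>} = PiE UNIV (\<lambda>i. {..\<beta> i})"
    by (auto simp: le_fun_def PiE_def Pi_def)
  then show ?thesis
    by (simp add: finite_PiE)
qed

lemma finite_multi_indices: "finite (multi_indices m :: 'n::finite multi_index set)"
proof (rule finite_subset[OF _ finite_mi_le])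
  show "(multi_indices m :: 'n multi_index set) \<subseteq> {\<alpha>. \<alpha> \<le> (\<lambda>_. m)}"
  proof
    fix \<alpha> :: "'n multi_index"
    assume \<alpha>: "\<alpha> \<in> multi_indices m"
    have "\<alpha> i \<le> mi_abs \<alpha>" for i
      unfolding mi_abs_def by (rule member_le_sum) auto
    with \<alpha> show "\<alpha> \<in> {\<alpha>. \<alpha> \<le> (\<lambda>_. m)}"
      by (auto simp: multi_indices_def le_fun_def intro: order_trans)
  qed
qed

definition mi_conv ::
  "('n::finite multi_index \<Rightarrow> 'a::comm_ring_1) \<Rightarrow> ('n multi_index \<Rightarrow> 'a) \<Rightarrow> 'n multi_index \<Rightarrow> 'a" where
  "mi_conv f g \<beta> = (\<Sum>\<alpha>\<in>{\<alpha>. \<alpha> \<le> \<beta>}. f \<alpha> * g (\<beta> - \<alpha>))"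

lemma mi_conv_cong:
  assumes "\<And>\<alpha>. \<alpha> \<le> \<beta> \<Longrightarrow> f \<alpha> = f' \<alpha>" and "\<And>\<alpha>. \<alpha> \<le> \<beta> \<Longrightarrow> g \<alpha> = g' \<alpha>"
  shows "mi_conv f g \<beta> = mi_conv f' g' \<beta>"
  unfolding mi_conv_def by (rule sum.cong) (simp_all add: assms mi_diff_le)

lemma mi_conv_commute: "mi_conv f g \<beta> = mi_conv g f \<beta>"
  unfolding mi_conv_def
  by (rule sum.reindex_bij_witness[of _ "\<lambda>\<alpha>. \<beta> - \<alpha>" "\<lambda>\<alpha>. \<beta> - \<alpha>"])
     (auto simp: mi_diff_diff mi_diff_le mult.commute)

lemma mi_conv_assoc: "mi_conv (mi_conv f g) h \<beta> = mi_conv f (mi_conv g h) \<beta>"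
proof -
  have "mi_conv (mi_conv f g) h \<beta>
      = (\<Sum>(\<alpha>, \<sigma>)\<in>(SIGMA \<alpha>:{\<alpha>. \<alpha> \<le> \<beta>}. {\<sigma>. \<sigma> \<le> \<alpha>}). f \<sigma> * g (\<alpha> - \<sigma>) * h (\<beta> - \<alpha>))"
    by (simp add: mi_conv_def sum_distrib_right finite_mi_le sum.Sigma)
  also have "\<dots> = (\<Sum>(\<sigma>, \<delta>)\<in>(SIGMA \<sigma>:{\<sigma>. \<sigma> \<le> \<beta>}. {\<delta>. \<delta> \<le> \<beta> - \<sigma>}).
      f \<sigma> * (g \<delta> * h (\<beta> - \<sigma> - \<delta>)))"
    by (rule sum.reindex_bij_witness
          [of _ "\<lambda>(\<sigma>, \<delta>). (\<lambda>i. \<sigma> i + \<delta> i, \<sigma>)" "\<lambda>(\<alpha>, \<sigma>). (\<sigma>, \<alpha> - \<sigma>)"])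
       (auto simp: mi_add_simps mult.assoc intro: order_trans[of _ _ \<beta>])
  also have "\<dots> = mi_conv f (mi_conv g h) \<beta>"
    by (simp add: mi_conv_def sum_distrib_left finite_mi_le sum.Sigma)
  finally show ?thesis .
qed

lemma mi_conv_unit: "mi_conv f (\<lambda>\<gamma>. of_bool (\<gamma> = (\<lambda>_. 0))) \<beta> = f \<beta>"
proof -
  have "mi_conv f (\<lambda>\<gamma>. of_bool (\<gamma> = (\<lambda>_. 0))) \<beta>
      = (\<Sum>\<alpha>\<in>{\<alpha>. \<alpha> \<le> \<beta>}. if \<beta> = \<alpha> then f \<alpha> else 0)"
    unfolding mi_conv_def
    by (rule sum.cong) (auto simp: fun_eq_iff le_fun_def dual_order.antisym)
  also have "\<dots> = f \<beta>"
    by (simp add: finite_mi_le)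
  finally show ?thesis .
qed

text \<open>
  If \<open>a 0 = 1\<close>, then the equation \<open>(b * a) \<beta> = 0\<close> can be solved for \<open>b \<beta>\<close>, whose coefficient in it
  is \<open>a 0\<close>.  The recursion is this solution for \<open>\<beta> \<noteq> 0\<close>.
\<close>

function mi_conv_inverse ::
  "('n::finite multi_index \<Rightarrow> 'a::comm_ring_1) \<Rightarrow> 'n multi_index \<Rightarrow> 'a" where
  "mi_conv_inverse a \<beta> = (if \<beta> = (\<lambda>_. 0) then 1
     else - (\<Sum>\<alpha>\<in>{\<alpha>. \<alpha> \<le> \<beta> \<and> \<alpha> \<noteq> \<beta>}. mi_conv_inverse a \<alpha> * a (\<beta> - \<alpha>)))"
  by pat_completeness auto
termination
  by (relation "Wellfounded.measure (\<lambda>(a, \<beta>). mi_abs \<beta>)") (auto simp: mi_abs_strict_mono)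

declare mi_conv_inverse.simps [simp del]

lemma mi_conv_inverse:
  assumes "a (\<lambda>_. 0) = 1"
  shows "mi_conv (mi_conv_inverse a) a \<beta> = of_bool (\<beta> = (\<lambda>_. 0))"
proof (cases "\<beta> = (\<lambda>_. 0)")
  case True
  with assms show ?thesis
    by (simp add: mi_conv_def mi_le_zero mi_conv_inverse.simps[of a "\<lambda>_. 0"] mi_diff_self)
next
  case False
  have "{\<alpha>. \<alpha> \<le> \<beta>} = insert \<beta> {\<alpha>. \<alpha> \<le> \<beta> \<and> \<alpha> \<noteq> \<beta>}"
    by auto
  moreover have "finite {\<alpha>. \<alpha> \<le> \<beta> \<and> \<alpha> \<noteq> \<beta>}"
    by (rule finite_subset[OF _ finite_mi_le]) auto
  ultimately show ?thesis
    using False assms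
    by (simp add: mi_conv_def mi_diff_self mi_conv_inverse.simps[of a \<beta>])
qed

text \<open>
  Only indices \<open>\<gamma>\<close> between \<open>\<alpha>\<close> and \<open>\<beta>\<close> contribute to the matrix product, and these again have length
  at most \<open>m\<close>; cutting off at length \<open>m\<close> therefore loses nothing, and shifting by \<open>\<alpha>\<close> turns the sum
  into a convolution.
\<close>

lemma sum_tri_matrix_mult:
  assumes "\<alpha> \<in> multi_indices m" and "\<beta> \<in> multi_indices m"
  shows "(\<Sum>\<gamma>\<in>multi_indices m. tri_matrix a \<alpha> \<gamma> * tri_matrix b \<gamma> \<beta>)
       = tri_matrix (mi_conv a b) \<alpha> \<beta>"
proof (cases "\<alpha> \<le> \<beta>")
  case True
  have "(\<Sum>\<gamma>\<in>multi_indices m. tri_matrix a \<alpha> \<gamma> * tri_matrix b \<gamma> \<beta>)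
      = (\<Sum>\<gamma>\<in>{\<gamma>. \<alpha> \<le> \<gamma> \<and> \<gamma> \<le> \<beta>}. a (\<gamma> - \<alpha>) * b (\<beta> - \<gamma>))"
    by (rule sum.mono_neutral_cong_right[OF finite_multi_indices])
       (use assms in \<open>auto simp: multi_indices_def tri_matrix_def dest: mi_abs_mono\<close>)
  also have "\<dots> = (\<Sum>\<delta>\<in>{\<delta>. \<delta> \<le> \<beta> - \<alpha>}. a \<delta> * b (\<beta> - \<alpha> - \<delta>))"
    by (rule sum.reindex_bij_witness[of _ "\<lambda>\<delta> i. \<alpha> i + \<delta> i" "\<lambda>\<gamma>. \<gamma> - \<alpha>"])
       (use True in \<open>auto simp: mi_add_simps\<close>)
  finally show ?thesis
    using True by (simp add: tri_matrix_def mi_conv_def)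
next
  case False
  then have "tri_matrix a \<alpha> \<gamma> * tri_matrix b \<gamma> \<beta> = 0" for \<gamma>
    by (auto simp: tri_matrix_def dest: order_trans)
  then have "(\<Sum>\<gamma>\<in>multi_indices m. tri_matrix a \<alpha> \<gamma> * tri_matrix b \<gamma> \<beta>) = 0"
    by (simp only: sum.neutral_const)
  with False show ?thesis
    by (simp add: tri_matrix_def)
qed

lemma tri_matrix_unit:
  "tri_matrix (\<lambda>\<gamma>. of_bool (\<gamma> = (\<lambda>_. 0))) \<alpha> \<beta> = of_bool (\<alpha> = \<beta>)"
  by (auto simp: tri_matrix_def fun_eq_iff le_fun_def dual_order.antisym)

text \<open>
  The triangular matrix of the convolution inverse of \<open>a\<close> is a two-sided inverse, because
  convolution is commutative.  Hence an inverse exists and the choice in \<open>matrix_inv_on\<close> yields one.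
\<close>

lemma matrix_inv_on_tri_matrix:
  fixes a :: "'n::finite multi_index \<Rightarrow> real"
  assumes "a (\<lambda>_. 0) = 1" and "\<alpha> \<in> multi_indices m" and "\<beta> \<in> multi_indices m"
  shows "(\<Sum>\<gamma>\<in>multi_indices m. matrix_inv_on (multi_indices m) (tri_matrix a) \<alpha> \<gamma> * tri_matrix a \<gamma> \<beta>)
       = of_bool (\<alpha> = \<beta>)"
proof -
  let ?I = "multi_indices m :: 'n multi_index set"
  let ?b = "mi_conv_inverse a"
  have ba: "mi_conv ?b a = (\<lambda>\<gamma>. of_bool (\<gamma> = (\<lambda>_. 0)))"
    by (rule ext) (rule mi_conv_inverse[of a, OF assms(1)])
  have ab: "mi_conv a ?b = (\<lambda>\<gamma>. of_bool (\<gamma> = (\<lambda>_. 0)))"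
    unfolding ba[symmetric] by (rule ext) (rule mi_conv_commute)
  have "\<exists>B. \<forall>\<alpha>\<in>?I. \<forall>\<beta>\<in>?I.
     (\<Sum>\<gamma>\<in>?I. tri_matrix a \<alpha> \<gamma> * B \<gamma> \<beta>) = of_bool (\<alpha> = \<beta>) \<and>
     (\<Sum>\<gamma>\<in>?I. B \<alpha> \<gamma> * tri_matrix a \<gamma> \<beta>) = of_bool (\<alpha> = \<beta>)"
    by (rule exI[of _ "tri_matrix ?b"]) (simp add: sum_tri_matrix_mult ab ba tri_matrix_unit)
  from someI_ex[OF this] assms(2,3) show ?thesis
    unfolding matrix_inv_on_def by blast
qed

lemma mi_conv_matrix_inv_on_tri_matrix:
  fixes a :: "'n::finite multi_index \<Rightarrow> real"
  assumes "a (\<lambda>_. 0) = 1" and "mi_abs \<beta> \<le> m"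
  shows "mi_conv (matrix_inv_on (multi_indices m) (tri_matrix a) (\<lambda>_. 0)) a \<beta>
       = of_bool (\<beta> = (\<lambda>_. 0))"
proof -
  let ?B = "matrix_inv_on (multi_indices m) (tri_matrix a)"
  have "mi_conv (?B (\<lambda>_. 0)) a \<beta> = (\<Sum>\<gamma>\<in>multi_indices m. ?B (\<lambda>_. 0) \<gamma> * tri_matrix a \<gamma> \<beta>)"
    unfolding mi_conv_def
    by (rule sum.mono_neutral_cong_left[OF finite_multi_indices])
       (use assms(2) in \<open>auto simp: multi_indices_def tri_matrix_def dest: mi_abs_mono\<close>)
  also have "\<dots> = of_bool ((\<lambda>_. 0) = \<beta>)"
    by (rule matrix_inv_on_tri_matrix)
       (use assms in \<open>auto simp: multi_indices_def mi_abs_zero\<close>)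
  finally show ?thesis
    by (simp add: eq_commute)
qed

section \<open>Iterated partial derivatives\<close>

lemma partial_derivI:
  assumes "((\<lambda>t. f (x + t *\<^sub>R axis i 1)) has_vector_derivative D) (at 0)"
  shows "partial_deriv i f x = D"
  unfolding partial_deriv_def using assms by (rule vector_derivative_at)

lemma coords: "distinct (coords :: 'n::finite list)" "set (coords :: 'n list) = UNIV"
proof -
  have "\<exists>l :: 'n list. distinct l \<and> set l = UNIV"
    using finite_distinct_list[of "UNIV :: 'n set"] by auto
  from someI_ex[OF this]
  show "distinct (coords :: 'n::finite list)" "set (coords :: 'n list) = UNIV"
    unfolding coords_def by auto
qed

lemma foldr_partial_deriv_zero:
  "(\<And>i. i \<in> set l \<Longrightarrow> \<beta> i = 0) \<Longrightarrow> foldr (\<lambda>i. partial_deriv i ^^ \<beta> i) l f = f"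
  by (induction l) auto

lemma mi_deriv_zero: "mi_deriv (\<lambda>_. 0) f = f"
  unfolding mi_deriv_def by (rule foldr_partial_deriv_zero) simp

text \<open>
  Raising the \<open>i\<close>-th exponent of \<open>\<beta>\<close> amounts to one more application of \<open>\<partial>\<^sub>i\<close> on the outside provided
  that \<open>\<beta>\<close> has no exponent at a coordinate enumerated before \<open>i\<close>.  Asking for it at all \<open>\<gamma> \<le> \<beta>\<close>
  makes it available for every term of a convolution at \<open>\<beta>\<close>, as in the Leibniz rule.
\<close>

definition outermost :: "'n::finite \<Rightarrow> 'n multi_index \<Rightarrow> bool" where
  "outermost i \<beta> \<longleftrightarrow>
     (\<forall>\<gamma>\<le>\<beta>. \<forall>f. mi_deriv (mi_inc i \<gamma>) f = partial_deriv i (mi_deriv \<gamma> f))"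

lemma outermostD:
  "outermost i \<beta> \<Longrightarrow> \<gamma> \<le> \<beta> \<Longrightarrow> mi_deriv (mi_inc i \<gamma>) f = partial_deriv i (mi_deriv \<gamma> f)"
  by (simp add: outermost_def)

lemma outermostI:
  assumes "coords = pre @ i # l" and "\<And>j. j \<in> set pre \<Longrightarrow> \<beta> j = 0"
  shows "outermost i \<beta>"
  unfolding outermost_def
proof (intro allI impI)
  fix \<gamma> f
  assume "\<gamma> \<le> \<beta>"
  with assms(2) have \<gamma>: "\<gamma> j = 0" if "j \<in> set pre" for j
    using that by (metis le_fun_def le_zero_eq)
  have "distinct (pre @ i # l)"
    unfolding assms(1)[symmetric] by (rule coords)
  then have "i \<notin> set pre" and "i \<notin> set l"
    by auto
  with \<gamma> have "mi_deriv \<gamma> f = foldr (\<lambda>i. partial_deriv i ^^ \<gamma> i) (i # l) f"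
    and "mi_deriv (mi_inc i \<gamma>) f = foldr (\<lambda>j. partial_deriv j ^^ mi_inc i \<gamma> j) (i # l) f"
    unfolding mi_deriv_def assms(1) foldr_append
    by (intro foldr_partial_deriv_zero; auto simp: mi_inc_apply)+
  moreover have "foldr (\<lambda>j. partial_deriv j ^^ mi_inc i \<gamma> j) l f
      = foldr (\<lambda>j. partial_deriv j ^^ \<gamma> j) l f"
    using \<open>i \<notin> set l\<close> by (intro foldr_cong) (auto simp: mi_inc_apply)
  ultimately show "mi_deriv (mi_inc i \<gamma>) f = partial_deriv i (mi_deriv \<gamma> f)"
    by (simp add: mi_inc_apply)
qed

text \<open>
  Every multi-index arises from \<open>0\<close> by raising exponents in the reverse of the enumerated order, and
  then each step is an outermost differentiation.  With this induction principle partial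
  derivatives never have to be interchanged.
\<close>

lemma mi_induct [case_names zero inc]:
  fixes P :: "'n::finite multi_index \<Rightarrow> bool"
  assumes zero: "P (\<lambda>_. 0)"
    and inc: "\<And>i \<beta>. outermost i \<beta> \<Longrightarrow> P \<beta> \<Longrightarrow> P (mi_inc i \<beta>)"
  shows "P \<beta>"
proof -
  have "P \<beta>" if "coords = pre @ l" and "\<And>j. j \<in> set pre \<Longrightarrow> \<beta> j = 0" for pre l \<beta>
    using that
  proof (induction l arbitrary: pre \<beta>)
    case Nil
    then have "\<beta> = (\<lambda>_. 0)"
      using coords(2) by (auto simp: fun_eq_iff)
    then show ?case
      using zero by simp
  next
    case (Cons i l)
    have "distinct (pre @ i # l)"
      unfolding Cons.prems(1)[symmetric] by (rule coords)
    then have i: "i \<notin> set pre"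
      by auto
    show ?case
      using Cons.prems(2)
    proof (induction "\<beta> i" arbitrary: \<beta>)
      case 0
      then show ?case
        using Cons.IH[of "pre @ [i]" \<beta>] Cons.prems(1) by auto
    next
      case (Suc k)
      let ?\<gamma> = "\<beta>(i := k)"
      have \<gamma>: "?\<gamma> j = 0" if "j \<in> set pre" for j
        using that i Suc.prems by auto
      have "P ?\<gamma>"
        using Suc.hyps(1)[of ?\<gamma>] \<gamma> by auto
      moreover have "outermost i ?\<gamma>"
        using outermostI[OF Cons.prems(1)] \<gamma> by blast
      ultimately have "P (mi_inc i ?\<gamma>)"
        by (rule inc[rotated])
      moreover have "mi_inc i ?\<gamma> = \<beta>"
        using Suc.hyps(2) by (auto simp: fun_eq_iff mi_inc_apply)
      ultimately show ?case
        by simp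
    qed
  qed
  from this[of "[]" coords] show ?thesis
    by simp
qed

lemma C_times_mi_deriv:
  "C_times k f \<Longrightarrow> mi_abs \<beta> \<le> k \<Longrightarrow> C_times (k - mi_abs \<beta>) (mi_deriv \<beta> f)"
proof (induction \<beta> rule: mi_induct)
  case zero
  then show ?case
    by (simp add: mi_abs_zero mi_deriv_zero)
next
  case (inc i \<beta>)
  then have "C_times (Suc (k - Suc (mi_abs \<beta>))) (mi_deriv \<beta> f)"
    by (simp add: mi_abs_inc Suc_diff_Suc)
  then show ?case
    using outermostD[OF inc.hyps(1) order_refl, of f] by (simp add: mi_abs_inc)
qed

lemma C_times_imp_continuous_on: "C_times k f \<Longrightarrow> continuous_on UNIV f"
  by (cases k) auto

text \<open>
  The counterpart of \<open>C_times\<close> on a set, with continuity left out: the Leibniz rule and the quotient rule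
  differentiate along one coordinate line at a time.  The restriction to a set is what the
  reciprocal of a function with zeros requires.
\<close>

primrec partially_differentiable_on ::
  "nat \<Rightarrow> (real ^ 'n::finite) set \<Rightarrow> (real ^ 'n \<Rightarrow> complex) \<Rightarrow> bool" where
  "partially_differentiable_on 0 U f \<longleftrightarrow> True"
| "partially_differentiable_on (Suc k) U f \<longleftrightarrow>
     (\<forall>i. (\<forall>x\<in>U. (\<lambda>t::real. f (x + t *\<^sub>R axis i 1)) differentiable (at 0)) \<and>
          partially_differentiable_on k U (partial_deriv i f))"

lemma eventually_line_in_open:
  fixes x :: "real ^ 'n::finite"
  assumes "open U" and "x \<in> U"
  shows "\<forall>\<^sub>F t in nhds (0::real). x + t *\<^sub>R axis i 1 \<in> U"
proof -
  have "open ((\<lambda>t::real. x + t *\<^sub>R axis i 1) -` U)"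
    by (intro open_vimage[OF assms(1)] continuous_intros)
  then show ?thesis
    using assms(2) by (auto simp: eventually_nhds)
qed

lemma has_vector_derivative_partial_deriv:
  assumes "partially_differentiable_on (Suc k) U f" and "x \<in> U"
  shows "((\<lambda>t. f (x + t *\<^sub>R axis i 1)) has_vector_derivative partial_deriv i f x) (at 0)"
  using assms by (auto simp: partial_deriv_def vector_derivative_works)

lemma has_vector_derivative_line_cong:
  fixes f g :: "real ^ 'n::finite \<Rightarrow> complex"
  assumes "open U" and "x \<in> U" and "\<And>y. y \<in> U \<Longrightarrow> f y = g y"
    and "((\<lambda>t. g (x + t *\<^sub>R axis i 1)) has_vector_derivative D) (at (0::real))"
  shows "((\<lambda>t. f (x + t *\<^sub>R axis i 1)) has_vector_derivative D) (at 0)"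
proof -
  have "\<forall>\<^sub>F t in nhds (0::real). g (x + t *\<^sub>R axis i 1) = f (x + t *\<^sub>R axis i 1)"
    using eventually_line_in_open[OF assms(1,2), of i] by eventually_elim (simp add: assms(3))
  then show ?thesis
    using assms has_vector_derivative_cong_ev[where S = UNIV and x = 0 and f' = D and
      f = "\<lambda>t. g (x + t *\<^sub>R axis i 1)" and g = "\<lambda>t. f (x + t *\<^sub>R axis i 1)"] by simp
qed

lemma partial_deriv_cong:
  fixes f g :: "real ^ 'n::finite \<Rightarrow> complex"
  assumes "open U" and "x \<in> U" and "\<And>y. y \<in> U \<Longrightarrow> f y = g y"
  shows "partial_deriv i f x = partial_deriv i g x"
proof -
  have "((\<lambda>t. f (x + t *\<^sub>R axis i 1)) has_vector_derivative D) (at 0) \<longleftrightarrow>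
        ((\<lambda>t. g (x + t *\<^sub>R axis i 1)) has_vector_derivative D) (at 0)" for D
    using has_vector_derivative_line_cong[OF assms(1,2), of f g]
      has_vector_derivative_line_cong[OF assms(1,2), of g f] assms(3) by auto
  then show ?thesis
    by (simp add: partial_deriv_def vector_derivative_def)
qed

lemma mi_deriv_cong:
  fixes f g :: "real ^ 'n::finite \<Rightarrow> complex"
  assumes "open U" and "\<And>y. y \<in> U \<Longrightarrow> f y = g y"
  shows "x \<in> U \<Longrightarrow> mi_deriv \<beta> f x = mi_deriv \<beta> g x"
proof (induction \<beta> arbitrary: x rule: mi_induct)
  case zero
  then show ?case
    using assms(2) by (simp add: mi_deriv_zero)
next
  case (inc i \<beta>)
  then show ?case
    using partial_deriv_cong[OF assms(1), of x "mi_deriv \<beta> f" "mi_deriv \<beta> g"]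
    by (simp add: outermostD[OF inc.hyps(1)])
qed

lemma mi_deriv_const: "mi_deriv \<beta> (\<lambda>_. c) = (\<lambda>_. if \<beta> = (\<lambda>_. 0) then c else 0)"
proof (induction \<beta> rule: mi_induct)
  case zero
  then show ?case
    by (simp add: mi_deriv_zero)
next
  case (inc i \<beta>)
  have "mi_inc i \<beta> \<noteq> (\<lambda>_. 0)"
    by (metis mi_inc_apply nat.distinct(1))
  moreover have "partial_deriv i (\<lambda>_. d) = (\<lambda>_. 0)" for d
    by (rule ext) (rule partial_derivI, simp)
  ultimately show ?case
    using inc.IH by (simp add: outermostD[OF inc.hyps(1)])
qed

lemma partially_differentiable_on_cong:
  assumes "open U"
  shows "(\<And>y. y \<in> U \<Longrightarrow> f y = g y) \<Longrightarrow> partially_differentiable_on k U f \<Longrightarrow>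
    partially_differentiable_on k U g"
proof (induction k arbitrary: f g)
  case 0
  then show ?case by simp
next
  case (Suc k)
  show ?case
    unfolding partially_differentiable_on.simps
  proof (intro allI conjI ballI)
    fix i x
    assume "x \<in> U"
    then have "((\<lambda>t. g (x + t *\<^sub>R axis i 1)) has_vector_derivative partial_deriv i f x) (at 0)"
      by (intro has_vector_derivative_line_cong[OF assms, of x g f]
          has_vector_derivative_partial_deriv[OF Suc.prems(2)]) (simp_all add: Suc.prems(1))
    then show "(\<lambda>t. g (x + t *\<^sub>R axis i 1)) differentiable at 0"
      by (rule differentiableI_vector)
  next
    fix i
    have "partially_differentiable_on k U (partial_deriv i f)"
      using Suc.prems(2) by simp
    then show "partially_differentiable_on k U (partial_deriv i g)"
      by (rule Suc.IH[rotated]) (rule partial_deriv_cong[OF assms], simp_all add: Suc.prems(1))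
  qed
qed

lemma partially_differentiable_onI:
  assumes "open U"
    and "\<And>i x. x \<in> U \<Longrightarrow> ((\<lambda>t. f (x + t *\<^sub>R axis i 1)) has_vector_derivative D i x) (at 0)"
    and "\<And>i. partially_differentiable_on k U (D i)"
  shows "partially_differentiable_on (Suc k) U f"
proof -
  have "partially_differentiable_on k U (partial_deriv i f)" for i
    using assms(3)[of i]
    by (rule partially_differentiable_on_cong[OF assms(1), rotated])
       (simp add: partial_derivI[OF assms(2)])
  moreover have "(\<lambda>t. f (x + t *\<^sub>R axis i 1)) differentiable at 0" if "x \<in> U" for i x
    using assms(2)[OF that] by (rule differentiableI_vector)
  ultimately show ?thesis
    by simp
qed

lemma partially_differentiable_on_Suc_imp:
  "partially_differentiable_on (Suc k) U f \<Longrightarrow> partially_differentiable_on k U f"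
  by (induction k arbitrary: f) auto

lemma partially_differentiable_on_subset:
  "partially_differentiable_on k U f \<Longrightarrow> V \<subseteq> U \<Longrightarrow> partially_differentiable_on k V f"
  by (induction k arbitrary: f) auto

lemma partially_differentiable_on_add:
  assumes "open U"
  shows "partially_differentiable_on k U f \<Longrightarrow> partially_differentiable_on k U g \<Longrightarrow>
    partially_differentiable_on k U (\<lambda>x. f x + g x)"
proof (induction k arbitrary: f g)
  case (Suc k)
  show ?case
  proof (rule partially_differentiable_onI[OF assms])
    fix i x
    assume "x \<in> U"
    then show "((\<lambda>t. f (x + t *\<^sub>R axis i 1) + g (x + t *\<^sub>R axis i 1)) has_vector_derivative
        partial_deriv i f x + partial_deriv i g x) (at 0)"
      by (intro has_vector_derivative_add has_vector_derivative_partial_deriv[OF Suc.prems(1)]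
          has_vector_derivative_partial_deriv[OF Suc.prems(2)])
  qed (use Suc in simp)
qed simp

lemma has_vector_derivative_line_mult:
  fixes f g :: "real ^ 'n::finite \<Rightarrow> complex"
  assumes "((\<lambda>t. f (x + t *\<^sub>R axis i 1)) has_vector_derivative D) (at (0::real))"
    and "((\<lambda>t. g (x + t *\<^sub>R axis i 1)) has_vector_derivative E) (at (0::real))"
  shows "((\<lambda>t. f (x + t *\<^sub>R axis i 1) * g (x + t *\<^sub>R axis i 1)) has_vector_derivative
    f x * E + D * g x) (at 0)"
  using has_vector_derivative_mult[OF assms] by simp

lemma partially_differentiable_on_mult:
  assumes "open U"
  shows "partially_differentiable_on k U f \<Longrightarrow> partially_differentiable_on k U g \<Longrightarrow>
    partially_differentiable_on k U (\<lambda>x. f x * g x)"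
proof (induction k arbitrary: f g)
  case (Suc k)
  show ?case
  proof (rule partially_differentiable_onI[OF assms])
    fix i x
    assume "x \<in> U"
    then show "((\<lambda>t. f (x + t *\<^sub>R axis i 1) * g (x + t *\<^sub>R axis i 1)) has_vector_derivative
        f x * partial_deriv i g x + partial_deriv i f x * g x) (at 0)"
      by (intro has_vector_derivative_line_mult has_vector_derivative_partial_deriv[OF Suc.prems(1)]
          has_vector_derivative_partial_deriv[OF Suc.prems(2)])
  next
    fix i
    show "partially_differentiable_on k U (\<lambda>x. f x * partial_deriv i g x + partial_deriv i f x * g x)"
      using Suc.prems by (intro partially_differentiable_on_add[OF assms] Suc.IH
          partially_differentiable_on_Suc_imp[OF Suc.prems(1)]
          partially_differentiable_on_Suc_imp[OF Suc.prems(2)]) simp_all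
  qed
qed simp

lemma partially_differentiable_on_const:
  fixes U :: "(real ^ 'n::finite) set"
  shows "partially_differentiable_on k U (\<lambda>_. c)"
proof (induction k arbitrary: c)
  case (Suc k)
  have "partial_deriv i (\<lambda>_::real ^ 'n. c) = (\<lambda>_. 0)" for i
    by (rule ext) (rule partial_derivI, simp)
  with Suc show ?case
    by simp
qed simp

text \<open>
  By induction on the order, since \<open>\<partial>\<^sub>i(1/f) = - \<partial>\<^sub>if \<cdot> (1/f)\<^sup>2\<close> is a product of functions that are
  differentiable one order less.
\<close>

lemma partially_differentiable_on_inverse:
  assumes "open U" and "\<And>x. x \<in> U \<Longrightarrow> f x \<noteq> 0"
  shows "partially_differentiable_on k U f \<Longrightarrow> partially_differentiable_on k U (\<lambda>x. 1 / f x)"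
proof (induction k)
  case (Suc k)
  show ?case
  proof (rule partially_differentiable_onI[OF assms(1)])
    fix i x
    assume x: "x \<in> U"
    have "((\<lambda>z::complex. 1 / z) has_field_derivative - (1 / (f x * f x))) (at (f x))"
      using assms(2)[OF x] by (auto intro!: derivative_eq_intros)
    then have "((\<lambda>t. 1 / f (x + t *\<^sub>R axis i 1)) has_vector_derivative
        partial_deriv i f x * (- (1 / (f x * f x)))) (at 0)"
      using field_vector_diff_chain_at[OF has_vector_derivative_partial_deriv[OF Suc.prems x],
          of "\<lambda>z. 1 / z" "- (1 / (f x * f x))" i]
      by (simp add: o_def)
    then show "((\<lambda>t. 1 / f (x + t *\<^sub>R axis i 1)) has_vector_derivative
        partial_deriv i f x * (- 1 * (1 / f x * (1 / f x)))) (at 0)"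
      by simp
  next
    fix i
    have "partially_differentiable_on k U (\<lambda>x. 1 / f x)"
      by (rule Suc.IH[OF partially_differentiable_on_Suc_imp[OF Suc.prems]])
    then show "partially_differentiable_on k U (\<lambda>x. partial_deriv i f x * (- 1 * (1 / f x * (1 / f x))))"
      using Suc.prems
      by (intro partially_differentiable_on_mult[OF assms(1)] partially_differentiable_on_const)
         simp_all
  qed
qed simp

lemma partially_differentiable_on_mi_deriv:
  "partially_differentiable_on k U f \<Longrightarrow> mi_abs \<beta> \<le> k \<Longrightarrow>
    partially_differentiable_on (k - mi_abs \<beta>) U (mi_deriv \<beta> f)"
proof (induction \<beta> rule: mi_induct)
  case zero
  then show ?case
    by (simp add: mi_abs_zero mi_deriv_zero)
next
  case (inc i \<beta>)
  then have "partially_differentiable_on (Suc (k - Suc (mi_abs \<beta>))) U (mi_deriv \<beta> f)"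
    by (simp add: mi_abs_inc Suc_diff_Suc)
  then show ?case
    using outermostD[OF inc.hyps(1) order_refl, of f] by (simp add: mi_abs_inc)
qed

text \<open>
  Division by the factorial removes the binomial coefficients from the Leibniz rule, which becomes
  a statement about convolutions.
\<close>

definition taylor_coeff ::
  "(real ^ 'n::finite \<Rightarrow> complex) \<Rightarrow> real ^ 'n \<Rightarrow> 'n multi_index \<Rightarrow> complex" where
  "taylor_coeff f x \<gamma> = mi_deriv \<gamma> f x / of_nat (mi_fact \<gamma>)"

text \<open>
  The factor \<open>\<gamma>\<^sub>i + 1\<close> compensates for the factorial of the raised multi-index.
\<close>

lemma has_vector_derivative_taylor_coeff:
  assumes "partially_differentiable_on k U f" and "mi_abs \<gamma> < k" and "x \<in> U"
    and "outermost i \<beta>" and "\<gamma> \<le> \<beta>"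
  shows "((\<lambda>t. taylor_coeff f (x + t *\<^sub>R axis i 1) \<gamma>) has_vector_derivative
    of_nat (Suc (\<gamma> i)) * taylor_coeff f x (mi_inc i \<gamma>)) (at 0)"
proof -
  have "partially_differentiable_on (Suc (k - Suc (mi_abs \<gamma>))) U (mi_deriv \<gamma> f)"
    using partially_differentiable_on_mi_deriv[OF assms(1), of \<gamma>] assms(2)
    by (simp add: Suc_diff_Suc)
  then have "((\<lambda>t. mi_deriv \<gamma> f (x + t *\<^sub>R axis i 1)) has_vector_derivative
      mi_deriv (mi_inc i \<gamma>) f x) (at 0)"
    unfolding outermostD[OF assms(4,5)] using assms(3)
    by (rule has_vector_derivative_partial_deriv)
  then have "((\<lambda>t. mi_deriv \<gamma> f (x + t *\<^sub>R axis i 1) / of_nat (mi_fact \<gamma>)) has_vector_derivative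
      mi_deriv (mi_inc i \<gamma>) f x / of_nat (mi_fact \<gamma>)) (at 0)"
    by (rule has_vector_derivative_divide)
  then show ?thesis
    unfolding taylor_coeff_def mi_fact_inc of_nat_mult
    by (simp del: of_nat_Suc)
qed

text \<open>
  The left-hand side is the formal derivative of the convolution at \<open>\<beta>\<close>, with \<open>f \<gamma>\<close> and \<open>g \<gamma>\<close> behaving
  like Taylor coefficients.  Collected by the index of \<open>f\<close>, the term \<open>f \<gamma> g (\<beta> + e\<^sub>i - \<gamma>)\<close> receives
  \<open>\<beta>\<^sub>i + 1 - \<gamma>\<^sub>i\<close> from the derivative of \<open>g\<close> and \<open>\<gamma>\<^sub>i\<close> from the derivative of \<open>f\<close>, hence \<open>\<beta>\<^sub>i + 1\<close> in total.
  Each of the two factors vanishes exactly at the indices \<open>\<gamma> \<le> \<beta> + e\<^sub>i\<close> that are missing from its sum.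
\<close>

lemma sum_mi_conv_Leibniz_step:
  fixes f g :: "'n::finite multi_index \<Rightarrow> 'a::comm_ring_1"
  shows "(\<Sum>\<gamma>\<in>{\<gamma>. \<gamma> \<le> \<beta>}. f \<gamma> * (of_nat (Suc ((\<beta> - \<gamma>) i)) * g (mi_inc i (\<beta> - \<gamma>)))
        + of_nat (Suc (\<gamma> i)) * f (mi_inc i \<gamma>) * g (\<beta> - \<gamma>))
    = of_nat (Suc (\<beta> i)) * mi_conv f g (mi_inc i \<beta>)"
proof -
  let ?h = "\<lambda>\<gamma>. f \<gamma> * g (mi_inc i \<beta> - \<gamma>)"
  have fin: "finite {\<gamma>. \<gamma> \<le> mi_inc i \<beta>}"
    by (rule finite_mi_le)
  have le: "\<gamma> \<le> \<beta>" if "\<gamma> \<le> mi_inc i \<beta>" "\<gamma> i \<noteq> Suc (\<beta> i)" for \<gamma>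
    using that unfolding le_fun_def mi_inc_apply
    by (metis (full_types) le_SucE)
  have "(\<Sum>\<gamma>\<in>{\<gamma>. \<gamma> \<le> \<beta>}. f \<gamma> * (of_nat (Suc ((\<beta> - \<gamma>) i)) * g (mi_inc i (\<beta> - \<gamma>))))
      = (\<Sum>\<gamma>\<in>{\<gamma>. \<gamma> \<le> mi_inc i \<beta>}. of_nat (Suc (\<beta> i) - \<gamma> i) * ?h \<gamma>)"
  proof (rule sum.mono_neutral_cong_left[OF fin])
    show "{\<gamma>. \<gamma> \<le> \<beta>} \<subseteq> {\<gamma>. \<gamma> \<le> mi_inc i \<beta>}"
      using le_mi_inc[of \<beta> i] by (auto intro: order_trans)
    show "\<forall>\<gamma>\<in>{\<gamma>. \<gamma> \<le> mi_inc i \<beta>} - {\<gamma>. \<gamma> \<le> \<beta>}. of_nat (Suc (\<beta> i) - \<gamma> i) * ?h \<gamma> = 0"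
      using le by fastforce
    show "f \<gamma> * (of_nat (Suc ((\<beta> - \<gamma>) i)) * g (mi_inc i (\<beta> - \<gamma>)))
        = of_nat (Suc (\<beta> i) - \<gamma> i) * ?h \<gamma>" if "\<gamma> \<in> {\<gamma>. \<gamma> \<le> \<beta>}" for \<gamma>
    proof -
      have "\<gamma> \<le> \<beta>" "\<gamma> i \<le> \<beta> i"
        using that by (auto simp: le_fun_def)
      then show ?thesis
        by (simp add: mi_inc_diff Suc_diff_le mult.left_commute del: of_nat_Suc)
    qed
  qed
  moreover have "(\<Sum>\<gamma>\<in>{\<gamma>. \<gamma> \<le> \<beta>}. of_nat (Suc (\<gamma> i)) * f (mi_inc i \<gamma>) * g (\<beta> - \<gamma>))
      = (\<Sum>\<gamma>\<in>{\<gamma>. \<gamma> \<le> mi_inc i \<beta> \<and> \<gamma> i \<noteq> 0}. of_nat (\<gamma> i) * ?h \<gamma>)"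
  proof (rule sum.reindex_bij_witness[of _ "\<lambda>\<gamma>. \<gamma>(i := \<gamma> i - 1)" "mi_inc i"])
    fix \<gamma>
    assume "\<gamma> \<in> {\<gamma>. \<gamma> \<le> mi_inc i \<beta> \<and> \<gamma> i \<noteq> 0}"
    then show "\<gamma>(i := \<gamma> i - 1) \<in> {\<gamma>. \<gamma> \<le> \<beta>}"
      by (auto simp: le_fun_def mi_inc_apply split: if_splits)
  qed (auto simp: mi_inc_apply mi_inc_mono mi_inc_diff_mi_inc mult.assoc fun_eq_iff
        simp del: of_nat_Suc)
  moreover have "\<dots> = (\<Sum>\<gamma>\<in>{\<gamma>. \<gamma> \<le> mi_inc i \<beta>}. of_nat (\<gamma> i) * ?h \<gamma>)"
    by (rule sum.mono_neutral_left[OF fin]) auto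
  ultimately have "(\<Sum>\<gamma>\<in>{\<gamma>. \<gamma> \<le> \<beta>}. f \<gamma> * (of_nat (Suc ((\<beta> - \<gamma>) i)) * g (mi_inc i (\<beta> - \<gamma>)))
        + of_nat (Suc (\<gamma> i)) * f (mi_inc i \<gamma>) * g (\<beta> - \<gamma>))
      = (\<Sum>\<gamma>\<in>{\<gamma>. \<gamma> \<le> mi_inc i \<beta>}. of_nat (Suc (\<beta> i) - \<gamma> i) * ?h \<gamma> + of_nat (\<gamma> i) * ?h \<gamma>)"
    by (simp only: sum.distrib)
  also have "\<dots> = (\<Sum>\<gamma>\<in>{\<gamma>. \<gamma> \<le> mi_inc i \<beta>}. of_nat (Suc (\<beta> i)) * ?h \<gamma>)"
  proof (rule sum.cong[OF refl])
    fix \<gamma>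
    assume "\<gamma> \<in> {\<gamma>. \<gamma> \<le> mi_inc i \<beta>}"
    then have "\<gamma> i \<le> Suc (\<beta> i)"
      by (auto simp: le_fun_def mi_inc_apply dest: spec[of _ i])
    then show "of_nat (Suc (\<beta> i) - \<gamma> i) * ?h \<gamma> + of_nat (\<gamma> i) * ?h \<gamma>
        = of_nat (Suc (\<beta> i)) * ?h \<gamma>"
      by (metis distrib_right le_add_diff_inverse2 of_nat_add)
  qed
  finally show ?thesis
    by (simp only: mi_conv_def sum_distrib_left)
qed

text \<open>
  The Leibniz rule.  Differentiating the identity at \<open>\<beta>\<close>, which holds on all of \<open>U\<close>, gives
  \<open>\<beta>\<^sub>i + 1\<close> times the identity at \<open>\<beta> + e\<^sub>i\<close>.
\<close>

lemma taylor_coeff_mult: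
  assumes "open U" and "partially_differentiable_on k U f" and "partially_differentiable_on k U g"
  shows "mi_abs \<beta> \<le> k \<Longrightarrow> x \<in> U \<Longrightarrow>
    taylor_coeff (\<lambda>y. f y * g y) x \<beta> = mi_conv (taylor_coeff f x) (taylor_coeff g x) \<beta>"
proof (induction \<beta> arbitrary: x rule: mi_induct)
  case zero
  then show ?case
    by (simp add: mi_conv_def mi_le_zero taylor_coeff_def mi_deriv_zero mi_fact_zero mi_diff_self)
next
  case (inc i \<beta>)
  let ?fg = "\<lambda>y. f y * g y"
  have \<beta>: "mi_abs \<beta> < k"
    using inc.prems by (simp add: mi_abs_inc)
  have "((\<lambda>t. mi_conv (taylor_coeff f (x + t *\<^sub>R axis i 1)) (taylor_coeff g (x + t *\<^sub>R axis i 1)) \<beta>)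
      has_vector_derivative of_nat (Suc (\<beta> i)) * mi_conv (taylor_coeff f x) (taylor_coeff g x) (mi_inc i \<beta>))
      (at 0)"
    unfolding mi_conv_def[of _ _ \<beta>] sum_mi_conv_Leibniz_step[symmetric]
  proof (intro has_vector_derivative_sum)
    fix \<gamma>
    assume "\<gamma> \<in> {\<gamma>. \<gamma> \<le> \<beta>}"
    then have \<gamma>: "\<gamma> \<le> \<beta>" "\<beta> - \<gamma> \<le> \<beta>"
      by (auto simp: mi_diff_le)
    then have k: "mi_abs \<gamma> < k" "mi_abs (\<beta> - \<gamma>) < k"
      using \<beta> mi_abs_mono by (meson le_less_trans)+
    show "((\<lambda>t. taylor_coeff f (x + t *\<^sub>R axis i 1) \<gamma> * taylor_coeff g (x + t *\<^sub>R axis i 1) (\<beta> - \<gamma>))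
        has_vector_derivative
        taylor_coeff f x \<gamma> * (of_nat (Suc ((\<beta> - \<gamma>) i)) * taylor_coeff g x (mi_inc i (\<beta> - \<gamma>)))
        + of_nat (Suc (\<gamma> i)) * taylor_coeff f x (mi_inc i \<gamma>) * taylor_coeff g x (\<beta> - \<gamma>)) (at 0)"
      by (rule has_vector_derivative_line_mult
          [of "\<lambda>x. taylor_coeff f x \<gamma>" x i _ "\<lambda>x. taylor_coeff g x (\<beta> - \<gamma>)"];
          rule has_vector_derivative_taylor_coeff[where \<beta> = \<beta>])
         (fact assms inc.prems inc.hyps \<gamma> k)+
  qed
  then have "((\<lambda>t. taylor_coeff ?fg (x + t *\<^sub>R axis i 1) \<beta>) has_vector_derivative
      of_nat (Suc (\<beta> i)) * mi_conv (taylor_coeff f x) (taylor_coeff g x) (mi_inc i \<beta>)) (at 0)"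
    using \<beta> inc.IH
    by (intro has_vector_derivative_line_cong[OF assms(1) inc.prems(2),
          of "\<lambda>y. taylor_coeff ?fg y \<beta>"
             "\<lambda>y. mi_conv (taylor_coeff f y) (taylor_coeff g y) \<beta>"]) auto
  moreover have "((\<lambda>t. taylor_coeff ?fg (x + t *\<^sub>R axis i 1) \<beta>) has_vector_derivative
      of_nat (Suc (\<beta> i)) * taylor_coeff ?fg x (mi_inc i \<beta>)) (at 0)"
    by (rule has_vector_derivative_taylor_coeff[where \<beta> = \<beta>,
          OF partially_differentiable_on_mult[OF assms]]) (fact \<beta> inc.prems inc.hyps order_refl)+
  ultimately have "of_nat (Suc (\<beta> i)) * taylor_coeff ?fg x (mi_inc i \<beta>)
      = of_nat (Suc (\<beta> i)) * mi_conv (taylor_coeff f x) (taylor_coeff g x) (mi_inc i \<beta>)"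
    by (rule vector_derivative_unique_at[rotated])
  then show ?case
    by (simp del: of_nat_Suc)
qed

text \<open>
  The Leibniz rule for the product \<open>(1/f) \<cdot> f\<close>, which is constantly \<open>1\<close> near \<open>x\<close>.
\<close>

lemma mi_conv_taylor_coeff_inverse:
  assumes "open U" and "\<And>x. x \<in> U \<Longrightarrow> f x \<noteq> 0" and "partially_differentiable_on k U f"
    and "mi_abs \<beta> \<le> k" and "x \<in> U"
  shows "mi_conv (taylor_coeff (\<lambda>y. 1 / f y) x) (taylor_coeff f x) \<beta> = of_bool (\<beta> = (\<lambda>_. 0))"
proof -
  have "mi_conv (taylor_coeff (\<lambda>y. 1 / f y) x) (taylor_coeff f x) \<beta>
      = taylor_coeff (\<lambda>y. 1 / f y * f y) x \<beta>"
    by (rule taylor_coeff_mult[OF assms(1), symmetric])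
       (use assms partially_differentiable_on_inverse in auto)
  also have "\<dots> = taylor_coeff (\<lambda>_. 1) x \<beta>"
    unfolding taylor_coeff_def
    using mi_deriv_cong[OF assms(1), of "\<lambda>y. 1 / f y * f y" "\<lambda>_. 1" x \<beta>] assms(2,5) by auto
  also have "\<dots> = of_bool (\<beta> = (\<lambda>_. 0))"
    by (simp add: taylor_coeff_def mi_deriv_const mi_fact_zero)
  finally show ?thesis .
qed

section \<open>Derivatives of the Fourier transform\<close>

lemma exp_fourier_phase: "exp (- 2 * of_real pi * \<i> * of_real (x \<bullet> \<xi>)) = exp (\<i> * of_real (- 2 * pi * (x \<bullet> \<xi>)))"
  by (simp add: mult_ac)

lemma norm_exp_i_diff_le: "norm (exp (\<i> * of_real (a + b)) - exp (\<i> * of_real a)) \<le> \<bar>b\<bar>"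
proof -
  have "exp (\<i> * of_real (a + b)) - exp (\<i> * of_real a)
      = exp (\<i> * of_real a) * (exp (\<i> * of_real b) - 1)"
    by (simp add: exp_add algebra_simps)
  then show ?thesis
    using abs_sin_x_le_abs_x[of "b / 2"] by (simp add: norm_mult dist_exp_i_1)
qed

lemma borel_measurable_fourier_integrand:
  fixes g :: "real ^ 'n::finite \<Rightarrow> complex"
  assumes "g \<in> borel_measurable lborel"
  shows "(\<lambda>x. g x * exp (- 2 * of_real pi * \<i> * of_real (x \<bullet> \<xi>))) \<in> borel_measurable lborel"
proof -
  have "(\<lambda>x::real^'n. exp (- 2 * of_real pi * \<i> * of_real (x \<bullet> \<xi>)) :: complex) \<in> borel_measurable borel"
    by (intro borel_measurable_continuous_onI continuous_intros)
  with assms show ?thesis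
    by simp
qed

lemma integrable_fourier_integrand:
  fixes g :: "real ^ 'n::finite \<Rightarrow> complex"
  assumes "integrable lborel g"
  shows "integrable lborel (\<lambda>x. g x * exp (- 2 * of_real pi * \<i> * of_real (x \<bullet> \<xi>)))"
  by (rule Bochner_Integration.integrable_bound[OF assms])
     (use assms borel_measurable_fourier_integrand in
       \<open>auto simp: exp_fourier_phase norm_mult simp del: of_real_mult\<close>)

lemma continuous_on_fourier:
  fixes g :: "real ^ 'n::finite \<Rightarrow> complex"
  assumes "integrable lborel g"
  shows "continuous_on UNIV (fourier g)"
  unfolding continuous_on_sequentially
proof (intro ballI allI impI, elim conjE)
  fix X :: "nat \<Rightarrow> real ^ 'n" and \<xi>
  assume X: "X \<longlonglongrightarrow> \<xi>"
  show "(fourier g \<circ> X) \<longlonglongrightarrow> fourier g \<xi>"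
    unfolding fourier_def o_def
  proof (rule integral_dominated_convergence[where w = "\<lambda>x. norm (g x)"])
    show "AE x in lborel. (\<lambda>n. g x * exp (- 2 * of_real pi * \<i> * of_real (x \<bullet> X n)))
        \<longlonglongrightarrow> g x * exp (- 2 * of_real pi * \<i> * of_real (x \<bullet> \<xi>))"
      by (intro AE_I2 tendsto_intros X)
  qed (use assms borel_measurable_fourier_integrand in
        \<open>auto simp: exp_fourier_phase norm_mult simp del: of_real_mult\<close>)
qed

lemma has_vector_derivative_at_0_iff:
  fixes f :: "real \<Rightarrow> complex"
  shows "(f has_vector_derivative D) (at 0) \<longleftrightarrow> ((\<lambda>t. (f t - f 0) / of_real t) \<longlongrightarrow> D) (at 0)"
proof -
  have "(f has_vector_derivative D) (at 0) \<longleftrightarrow>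
      ((\<lambda>t. norm (f t - f 0 - t *\<^sub>R D) / norm t) \<longlongrightarrow> 0) (at 0)"
    by (simp add: has_vector_derivative_def has_derivative_at bounded_linear_scaleR_left)
  also have "\<dots> \<longleftrightarrow> ((\<lambda>t. norm ((f t - f 0) / of_real t - D)) \<longlongrightarrow> 0) (at 0)"
  proof (rule filterlim_cong[OF refl refl])
    have "norm (f t - f 0 - t *\<^sub>R D) / norm t = norm ((f t - f 0) / of_real t - D)" if "t \<noteq> 0" for t
    proof -
      have "(f t - f 0) / of_real t - D = (f t - f 0 - t *\<^sub>R D) / of_real t"
        using that by (simp add: scaleR_conv_of_real field_simps)
      then show ?thesis
        by (simp add: norm_divide)
    qed
    then show "\<forall>\<^sub>F t in at 0. norm (f t - f 0 - t *\<^sub>R D) / norm t = norm ((f t - f 0) / of_real t - D)"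
      by (auto simp: eventually_at_filter)
  qed
  also have "\<dots> \<longleftrightarrow> ((\<lambda>t. (f t - f 0) / of_real t) \<longlongrightarrow> D) (at 0)"
    by (simp add: tendsto_norm_zero_iff LIM_zero_iff)
  finally show ?thesis .
qed

text \<open>
  Differentiation under the integral sign: the difference quotients of the exponential in the
  direction of the \<open>i\<close>-th axis are bounded by \<open>2\<pi>|x\<^sub>i|\<close>, so dominated convergence applies.
\<close>

lemma has_vector_derivative_fourier:
  fixes g :: "real ^ 'n::finite \<Rightarrow> complex"
  assumes g: "integrable lborel g" and xg: "integrable lborel (\<lambda>x. of_real (x $ i) * g x)"
  shows "((\<lambda>t. fourier g (\<xi> + t *\<^sub>R axis i 1)) has_vector_derivative
    - 2 * of_real pi * \<i> * fourier (\<lambda>x. of_real (x $ i) * g x) \<xi>) (at 0)"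
proof -
  define e where "e x \<xi> = exp (- 2 * of_real pi * \<i> * of_real (x \<bullet> \<xi>))" for x \<xi> :: "real ^ 'n"
  let ?D = "\<lambda>x. - 2 * of_real pi * \<i> * (of_real (x $ i) * g x * e x \<xi>)"
  let ?q = "\<lambda>t x. (g x * e x (\<xi> + t *\<^sub>R axis i 1) - g x * e x \<xi>) / of_real t"
  have int: "integrable lborel (\<lambda>x. g x * e x \<zeta>)" for \<zeta>
    unfolding e_def by (rule integrable_fourier_integrand[OF g])
  have e_line: "e x (\<xi> + t *\<^sub>R axis i 1)
      = exp (\<i> * of_real (- 2 * pi * (x \<bullet> \<xi>) + (- 2 * pi * (x $ i) * t)))" for x t
    unfolding e_def exp_fourier_phase
    by (simp add: inner_add_right inner_axis algebra_simps)
  have deriv: "((\<lambda>t. e x (\<xi> + t *\<^sub>R axis i 1)) has_vector_derivative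
      - 2 * of_real pi * \<i> * of_real (x $ i) * e x \<xi>) (at 0)" for x
  proof -
    let ?p = "- 2 * of_real pi * \<i> * of_real (x \<bullet> \<xi>)" and ?r = "- 2 * of_real pi * \<i> * of_real (x $ i)"
    have "((\<lambda>z. exp (?p + z * ?r)) has_field_derivative ?r * exp ?p) (at (of_real 0))"
      by (auto intro!: derivative_eq_intros)
    then have "((\<lambda>t. exp (?p + of_real t * ?r)) has_vector_derivative ?r * exp ?p) (at (0::real))"
      by (rule has_vector_derivative_real_field)
    moreover have "exp (?p + of_real t * ?r) = e x (\<xi> + t *\<^sub>R axis i 1)" for t
      unfolding e_def by (simp add: inner_add_right inner_axis algebra_simps)
    ultimately show ?thesis
      by (simp add: e_def)
  qed
  have lim: "((\<lambda>t. LINT x|lborel. ?q t x) \<longlongrightarrow> (LINT x|lborel. ?D x)) (at 0)"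
    unfolding tendsto_at_iff_sequentially
  proof (intro allI impI)
    fix X :: "nat \<Rightarrow> real"
    assume X0: "\<forall>n. X n \<in> UNIV - {0}" and X: "X \<longlonglongrightarrow> 0"
    show "((\<lambda>t. LINT x|lborel. ?q t x) \<circ> X) \<longlonglongrightarrow> (LINT x|lborel. ?D x)"
      unfolding o_def
    proof (rule integral_dominated_convergence[where w = "\<lambda>x. 2 * pi * norm (of_real (x $ i) * g x)"])
      show "?D \<in> borel_measurable lborel"
        unfolding e_def
        by (intro borel_measurable_times[OF borel_measurable_const]
            borel_measurable_fourier_integrand borel_measurable_integrable xg)
      show "?q (X n) \<in> borel_measurable lborel" for n
        using int by (intro borel_measurable_divide borel_measurable_diff) auto
      show "integrable lborel (\<lambda>x. 2 * pi * norm (of_real (x $ i) * g x))"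
        using xg by (intro integrable_mult_right integrable_norm)
      show "AE x in lborel. (\<lambda>n. ?q (X n) x) \<longlonglongrightarrow> ?D x"
      proof (rule AE_I2)
        fix x
        have "((\<lambda>t. (e x (\<xi> + t *\<^sub>R axis i 1) - e x \<xi>) / of_real t) \<longlongrightarrow>
            - 2 * of_real pi * \<i> * of_real (x $ i) * e x \<xi>) (at 0)"
          using deriv[of x] unfolding has_vector_derivative_at_0_iff by simp
        then have "((\<lambda>t. g x * ((e x (\<xi> + t *\<^sub>R axis i 1) - e x \<xi>) / of_real t)) \<longlongrightarrow> ?D x) (at 0)"
          by (rule tendsto_mult_left[THEN tendsto_eq_rhs]) (simp add: mult_ac)
        then have "((\<lambda>t. ?q t x) \<longlongrightarrow> ?D x) (at 0)"
          by (simp add: right_diff_distrib)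
        then show "(\<lambda>n. ?q (X n) x) \<longlonglongrightarrow> ?D x"
          using X0 X unfolding tendsto_at_iff_sequentially o_def by blast
      qed
      show "AE x in lborel. norm (?q (X n) x) \<le> 2 * pi * norm (of_real (x $ i) * g x)" for n
      proof (rule AE_I2)
        fix x
        have "norm (e x (\<xi> + X n *\<^sub>R axis i 1) - e x \<xi>) \<le> \<bar>- 2 * pi * (x $ i) * X n\<bar>"
          unfolding e_line unfolding e_def exp_fourier_phase by (rule norm_exp_i_diff_le)
        then have "norm (g x) * norm (e x (\<xi> + X n *\<^sub>R axis i 1) - e x \<xi>) / \<bar>X n\<bar>
            \<le> norm (g x) * \<bar>- 2 * pi * (x $ i) * X n\<bar> / \<bar>X n\<bar>"
          by (intro divide_right_mono mult_left_mono) auto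
        then show "norm (?q (X n) x) \<le> 2 * pi * norm (of_real (x $ i) * g x)"
          using X0 by (simp add: norm_mult norm_divide abs_mult mult_ac flip: right_diff_distrib)
      qed
    qed
  qed
  have q: "(LINT x|lborel. ?q t x) = (fourier g (\<xi> + t *\<^sub>R axis i 1) - fourier g \<xi>) / of_real t" for t
    using int by (simp add: fourier_def e_def)
  have D: "(LINT x|lborel. ?D x) = - 2 * of_real pi * \<i> * fourier (\<lambda>x. of_real (x $ i) * g x) \<xi>"
    by (simp add: fourier_def e_def)
  show ?thesis
    using lim unfolding has_vector_derivative_at_0_iff q D by simp
qed

text \<open>
  Up to a constant, \<open>\<partial>\<^sub>i\<close> of the transform of \<open>g\<close> is the transform of \<open>x\<^sub>i g\<close>, for which the moments of
  length at most \<open>k\<close> exist if those of \<open>g\<close> of length at most \<open>k + 1\<close> do.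
\<close>

lemma partially_differentiable_on_fourier:
  fixes g :: "real ^ 'n::finite \<Rightarrow> complex"
  shows "(\<And>\<gamma>. mi_abs \<gamma> \<le> k \<Longrightarrow> integrable lborel (\<lambda>x. of_real (mi_power x \<gamma>) * g x)) \<Longrightarrow>
    partially_differentiable_on k UNIV (fourier g)"
proof (induction k arbitrary: g)
  case (Suc k)
  have g: "integrable lborel g"
    using Suc.prems[of "\<lambda>_. 0"] by (simp add: mi_power_zero mi_abs_zero)
  have xg: "integrable lborel (\<lambda>x. of_real (x $ i) * g x)" for i
    using Suc.prems[of "mi_inc i (\<lambda>_. 0)"]
    by (simp add: mi_power_inc mi_power_zero mi_abs_zero mi_abs_inc)
  show ?case
  proof (rule partially_differentiable_onI[OF open_UNIV])
    show "((\<lambda>t. fourier g (\<xi> + t *\<^sub>R axis i 1)) has_vector_derivative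
      - 2 * of_real pi * \<i> * fourier (\<lambda>x. of_real (x $ i) * g x) \<xi>) (at 0)" for i \<xi>
      by (rule has_vector_derivative_fourier[OF g xg])
    show "partially_differentiable_on k UNIV
        (\<lambda>\<xi>. - 2 * of_real pi * \<i> * fourier (\<lambda>x. of_real (x $ i) * g x) \<xi>)" for i
    proof (intro partially_differentiable_on_mult partially_differentiable_on_const open_UNIV Suc.IH)
      fix \<gamma> :: "'n multi_index"
      assume "mi_abs \<gamma> \<le> k"
      then show "integrable lborel (\<lambda>x. of_real (mi_power x \<gamma>) * (of_real (x $ i) * g x))"
        using Suc.prems[of "mi_inc i \<gamma>"] by (simp add: mi_power_inc mi_abs_inc mult_ac)
    qed
  qed
qed simp

lemma mi_deriv_fourier:
  fixes g :: "real ^ 'n::finite \<Rightarrow> complex"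
  assumes "\<And>\<gamma>. mi_abs \<gamma> \<le> k \<Longrightarrow> integrable lborel (\<lambda>x. of_real (mi_power x \<gamma>) * g x)"
  shows "mi_abs \<beta> \<le> k \<Longrightarrow> mi_deriv \<beta> (fourier g)
    = (\<lambda>\<xi>. (- 2 * of_real pi * \<i>) ^ mi_abs \<beta> * fourier (\<lambda>x. of_real (mi_power x \<beta>) * g x) \<xi>)"
proof (induction \<beta> rule: mi_induct)
  case zero
  then show ?case
    by (simp add: mi_deriv_zero mi_power_zero mi_abs_zero)
next
  case (inc i \<beta>)
  let ?c = "(- 2 * of_real pi * \<i>) ^ mi_abs \<beta>"
  show ?case
    unfolding outermostD[OF inc.hyps order_refl]
  proof (rule ext, rule partial_derivI)
    fix \<xi>
    have "((\<lambda>t. fourier (\<lambda>x. of_real (mi_power x \<beta>) * g x) (\<xi> + t *\<^sub>R axis i 1))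
        has_vector_derivative - 2 * of_real pi * \<i> *
          fourier (\<lambda>x. of_real (x $ i) * (of_real (mi_power x \<beta>) * g x)) \<xi>) (at 0)"
      using assms[of \<beta>] assms[of "mi_inc i \<beta>"] inc.prems
      by (intro has_vector_derivative_fourier) (simp_all add: mi_abs_inc mi_power_inc mult.assoc)
    then have "((\<lambda>t. ?c * fourier (\<lambda>x. of_real (mi_power x \<beta>) * g x) (\<xi> + t *\<^sub>R axis i 1))
        has_vector_derivative ?c * (- 2 * of_real pi * \<i> *
          fourier (\<lambda>x. of_real (x $ i) * (of_real (mi_power x \<beta>) * g x)) \<xi>)) (at 0)"
      by (rule has_vector_derivative_mult_right)
    then show "((\<lambda>t. mi_deriv \<beta> (fourier g) (\<xi> + t *\<^sub>R axis i 1)) has_vector_derivative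
        (- 2 * of_real pi * \<i>) ^ mi_abs (mi_inc i \<beta>) *
          fourier (\<lambda>x. of_real (mi_power x (mi_inc i \<beta>)) * g x) \<xi>) (at 0)"
      using inc.IH inc.prems by (simp add: mi_abs_inc mi_power_inc mult_ac)
  qed
qed

lemma taylor_coeff_fourier:
  fixes g :: "real ^ 'n::finite \<Rightarrow> complex"
  assumes "\<And>\<gamma>. mi_abs \<gamma> \<le> k \<Longrightarrow> integrable lborel (\<lambda>x. of_real (mi_power x \<gamma>) * g x)"
    and "mi_abs \<beta> \<le> k"
  shows "taylor_coeff (fourier g) 0 \<beta> = (- 2 * of_real pi * \<i>) ^ mi_abs \<beta> *
    ((LINT x|lborel. of_real (mi_power x \<beta>) * g x) / of_nat (mi_fact \<beta>))"
  using mi_deriv_fourier[OF assms] by (simp add: taylor_coeff_def) (simp add: fourier_def)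

section \<open>Integration by parts\<close>

lemma integral_translation:
  fixes f :: "'a::euclidean_space \<Rightarrow> 'b::{banach, second_countable_topology}"
  assumes "f \<in> borel_measurable lborel"
  shows "(LINT x|lborel. f (x + c)) = (LINT x|lborel. f x)"
    and "integrable lborel (\<lambda>x. f (x + c)) \<longleftrightarrow> integrable lborel f"
proof -
  have "f \<in> borel_measurable borel"
    using assms by simp
  then have "(LINT x|distr lborel borel ((+) c). f x) = (LINT x|lborel. f (c + x))"
    and "integrable (distr lborel borel ((+) c)) f \<longleftrightarrow> integrable lborel (\<lambda>x. f (c + x))"
    by (auto intro!: integral_distr integrable_distr_eq)
  then show "(LINT x|lborel. f (x + c)) = (LINT x|lborel. f x)"
    and "integrable lborel (\<lambda>x. f (x + c)) \<longleftrightarrow> integrable lborel f"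
    unfolding lborel_distr_plus by (simp_all add: add.commute)
qed

text \<open>
  By translation invariance \<open>\<psi> (x + v) - \<psi> x = \<integral>\<^sub>0\<^sup>1 D (x + t v) dt\<close> has integral \<open>0\<close> over \<open>x\<close>.  After
  exchanging the integrals, the inner one is \<open>\<integral> D\<close> for every \<open>t\<close>, again by translation invariance.
\<close>

lemma integral_directional_derivative_eq_0:
  fixes \<psi> D :: "'a::euclidean_space \<Rightarrow> complex"
  assumes \<psi>: "integrable lborel \<psi>" and D: "integrable lborel D" and "continuous_on UNIV D"
    and deriv: "\<And>x. ((\<lambda>t. \<psi> (x + t *\<^sub>R v)) has_vector_derivative D x) (at 0)"
  shows "(LINT x|lborel. D x) = 0"
proof -
  let ?g = "\<lambda>(t::real) x. indicator {0..1} t *\<^sub>R D (x + t *\<^sub>R v)"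
  have "(\<lambda>p::real \<times> 'a. D (snd p + fst p *\<^sub>R v)) \<in> borel_measurable borel"
    by (intro borel_measurable_continuous_onI continuous_intros
        continuous_on_compose2[OF assms(3)]) auto
  moreover have sets: "sets (lborel \<Otimes>\<^sub>M lborel) = sets (borel :: (real \<times> 'a) measure)"
    by (metis lborel_prod sets_lborel)
  moreover have "(\<lambda>p::real \<times> 'a. indicator {0..1} (fst p) :: real)
      \<in> borel_measurable (lborel \<Otimes>\<^sub>M lborel)"
    by measurable
  ultimately have "case_prod ?g \<in> borel_measurable (lborel \<Otimes>\<^sub>M lborel)"
    unfolding case_prod_beta'
    by (intro borel_measurable_scaleR) (auto simp: measurable_cong_sets[OF sets refl])
  then have int: "integrable (lborel \<Otimes>\<^sub>M lborel) (case_prod ?g)"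
  proof (rule lborel_pair.Fubini_integrable)
    have "(LINT x|lborel. norm (D (x + t *\<^sub>R v))) = (LINT x|lborel. norm (D x))" for t
      using D by (intro integral_translation(1)[of "\<lambda>x. norm (D x)"]) auto
    then show "integrable lborel (\<lambda>t. LINT x|lborel. norm (case_prod ?g (t, x)))"
      by (simp add: integrable_mult_left_iff)
    show "AE t in lborel. integrable lborel (\<lambda>x. case_prod ?g (t, x))"
      using D by (simp add: integral_translation(2))
  qed
  have "(LINT x|lborel. LINT t|lborel. ?g t x) = (LINT x|lborel. \<psi> (x + v) - \<psi> x)"
  proof (rule Bochner_Integration.integral_cong[OF refl])
    fix x
    have "(LINT t|lborel. ?g t x) = \<psi> (x + 1 *\<^sub>R v) - \<psi> (x + 0 *\<^sub>R v)"
    proof (rule integral_FTC_atLeastAtMost)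
      fix t :: real
      have "((\<lambda>s. \<psi> (x + t *\<^sub>R v + s *\<^sub>R v)) has_vector_derivative D (x + t *\<^sub>R v)) (at (t - t))"
        using deriv[of "x + t *\<^sub>R v"] by simp
      then have "(((\<lambda>s. \<psi> (x + t *\<^sub>R v + s *\<^sub>R v)) \<circ> (\<lambda>s. s - t)) has_vector_derivative
          1 *\<^sub>R D (x + t *\<^sub>R v)) (at t)"
        by (intro vector_diff_chain_at) (auto intro!: derivative_eq_intros)
      moreover have "(\<lambda>s. \<psi> (x + t *\<^sub>R v + s *\<^sub>R v)) \<circ> (\<lambda>s. s - t) = (\<lambda>s. \<psi> (x + s *\<^sub>R v))"
        by (simp add: fun_eq_iff algebra_simps)
      ultimately show "((\<lambda>s. \<psi> (x + s *\<^sub>R v)) has_vector_derivative D (x + t *\<^sub>R v))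
          (at t within {0..1})"
        by (simp add: has_vector_derivative_at_within)
    next
      show "continuous_on {0..1} (\<lambda>t. D (x + t *\<^sub>R v))"
        by (intro continuous_on_compose2[OF assms(3)] continuous_intros) auto
    qed simp
    then show "(LINT t|lborel. ?g t x) = \<psi> (x + v) - \<psi> x"
      by simp
  qed
  also have "\<dots> = 0"
    using \<psi> by (simp add: integral_translation)
  finally have "0 = (LINT x|lborel. LINT t|lborel. ?g t x)"
    by simp
  also have "\<dots> = (LINT t|lborel. LINT x|lborel. ?g t x)"
    using int by (rule lborel_pair.Fubini_integral)
  also have "\<dots> = (LINT t|lborel. indicator {0..1::real} t *\<^sub>R (LINT x|lborel. D x))"
    using D by (simp add: integral_translation(1))
  also have "\<dots> = (LINT x|lborel. D x)"
    by simp
  finally show ?thesis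
    by simp
qed

lemma continuous_on_mi_power: "continuous_on UNIV (\<lambda>x. mi_power x \<alpha>)"
  unfolding mi_power_def by (intro continuous_intros)

lemma abs_mi_power_le: "\<bar>mi_power x \<alpha>\<bar> \<le> norm x ^ mi_abs \<alpha>"
proof -
  have "\<bar>mi_power x \<alpha>\<bar> = (\<Prod>i\<in>UNIV. \<bar>x $ i\<bar> ^ \<alpha> i)"
    by (simp add: mi_power_def abs_prod power_abs)
  also have "\<dots> \<le> (\<Prod>i\<in>UNIV. norm x ^ \<alpha> i)"
    by (intro prod_mono conjI power_mono component_le_norm_cart) auto
  finally show ?thesis
    by (simp add: mi_abs_def power_sum)
qed

text \<open>
  Near the origin, where \<open>|x|\<^sup>m\<close> does not control lower powers, continuity of \<open>g\<close> gives integrability.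
\<close>

lemma integrable_mi_power_mult:
  fixes g :: "real ^ 'n::finite \<Rightarrow> complex"
  assumes g: "continuous_on UNIV g" and int: "integrable lborel (\<lambda>x. norm x ^ m * norm (g x))"
    and "mi_abs \<alpha> \<le> m"
  shows "integrable lborel (\<lambda>x. of_real (mi_power x \<alpha>) * g x)"
proof (rule Bochner_Integration.integrable_bound)
  have "integrable lborel (\<lambda>x. indicator (cball 0 1) x *\<^sub>R norm (g x))"
    by (intro borel_integrable_compact continuous_intros continuous_on_subset[OF g]) auto
  with int show "integrable lborel
      (\<lambda>x. indicator (cball 0 1) x *\<^sub>R norm (g x) + norm x ^ m * norm (g x))"
    by (rule Bochner_Integration.integrable_add[rotated])
  have "(\<lambda>x. of_real (mi_power x \<alpha>) * g x) \<in> borel_measurable borel"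
    by (intro borel_measurable_continuous_onI continuous_intros continuous_on_mi_power g)
  then show "(\<lambda>x. of_real (mi_power x \<alpha>) * g x) \<in> borel_measurable lborel"
    by simp
  have "\<bar>mi_power x \<alpha>\<bar> \<le> indicator (cball 0 1) x + norm x ^ m" for x
  proof (cases "norm x \<le> 1")
    case True
    then have "norm x ^ mi_abs \<alpha> \<le> 1"
      by (simp add: power_le_one)
    moreover have "0 \<le> norm x ^ m"
      by simp
    ultimately have "norm x ^ mi_abs \<alpha> \<le> 1 + norm x ^ m"
      by linarith
    then show ?thesis
      using True abs_mi_power_le[of x \<alpha>] by simp
  next
    case False
    then have "norm x ^ mi_abs \<alpha> \<le> norm x ^ m"
      using assms(3) by (intro power_increasing) auto
    with abs_mi_power_le have "\<bar>mi_power x \<alpha>\<bar> \<le> norm x ^ m"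
      by (rule order_trans)
    with False show ?thesis
      by simp
  qed
  from mult_right_mono[OF this norm_ge_zero]
  show "AE x in lborel. norm (of_real (mi_power x \<alpha>) * g x) \<le>
      norm (indicator (cball 0 1) x *\<^sub>R norm (g x) + norm x ^ m * norm (g x))"
    by (intro AE_I2) (simp add: norm_mult algebra_simps)
qed

text \<open>
  If \<open>\<alpha> i = 0\<close>, then the truncated exponent \<open>\<alpha> i - 1\<close> is harmless because of the factor \<open>\<alpha> i\<close>.
\<close>

lemma has_real_derivative_mi_power:
  "((\<lambda>t. mi_power (x + t *\<^sub>R axis i 1) \<alpha>) has_real_derivative
    real (\<alpha> i) * mi_power x (\<alpha>(i := \<alpha> i - 1))) (at 0)"
proof -
  have split: "mi_power y \<beta> = (y $ i) ^ \<beta> i * (\<Prod>j\<in>UNIV - {i}. (y $ j) ^ \<beta> j)" for y \<beta>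
    by (simp add: mi_power_def prod.remove[of UNIV i])
  have "(\<Prod>j\<in>UNIV - {i}. ((x + t *\<^sub>R axis i 1) $ j) ^ \<alpha> j) = (\<Prod>j\<in>UNIV - {i}. (x $ j) ^ \<alpha> j)" for t
    by (rule prod.cong) (auto simp: axis_def)
  then show ?thesis
    unfolding split
    by (auto simp: axis_def intro!: derivative_eq_intros)
qed

text \<open>
  Integration by parts: \<open>\<partial>\<^sub>i (x\<^sup>\<alpha> g)\<close> is integrable and has integral \<open>0\<close>.
\<close>

lemma integral_mi_power_partial_deriv:
  fixes g :: "real ^ 'n::finite \<Rightarrow> complex"
  assumes g: "C_times (Suc k) g"
    and int: "\<And>\<gamma>. mi_abs \<gamma> \<le> m \<Longrightarrow> integrable lborel (\<lambda>x. of_real (mi_power x \<gamma>) * g x)"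
    and int': "\<And>\<gamma>. mi_abs \<gamma> \<le> m \<Longrightarrow>
      integrable lborel (\<lambda>x. of_real (mi_power x \<gamma>) * partial_deriv i g x)"
    and \<alpha>: "mi_abs \<alpha> \<le> m"
  shows "(LINT x|lborel. of_real (mi_power x \<alpha>) * partial_deriv i g x)
    = - of_nat (\<alpha> i) * (LINT x|lborel. of_real (mi_power x (\<alpha>(i := \<alpha> i - 1))) * g x)"
proof -
  let ?\<alpha> = "\<alpha>(i := \<alpha> i - 1)"
  let ?D = "\<lambda>x. of_real (mi_power x \<alpha>) * partial_deriv i g x
    + of_nat (\<alpha> i) * (of_real (mi_power x ?\<alpha>) * g x)"
  have cont: "continuous_on UNIV g" "continuous_on UNIV (partial_deriv i g)"
    using g C_times_imp_continuous_on by auto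
  have "?\<alpha> \<le> \<alpha>"
    by (simp add: le_fun_def)
  from mi_abs_mono[OF this] \<alpha> have "mi_abs ?\<alpha> \<le> m"
    by linarith
  then have int1: "integrable lborel (\<lambda>x. of_real (mi_power x \<alpha>) * partial_deriv i g x)"
    and int2: "integrable lborel (\<lambda>x. of_nat (\<alpha> i) * (of_real (mi_power x ?\<alpha>) * g x))"
    using \<alpha> by (auto intro!: int int')
  have "(LINT x|lborel. ?D x) = 0"
  proof (rule integral_directional_derivative_eq_0[OF int[OF \<alpha>]])
    show "integrable lborel ?D"
      using int1 int2 by (rule Bochner_Integration.integrable_add)
    show "continuous_on UNIV ?D"
      by (intro continuous_intros continuous_on_mi_power cont)
    fix x
    have "((\<lambda>t. g (x + t *\<^sub>R axis i 1)) has_vector_derivative partial_deriv i g x) (at 0)"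
      using g by (simp add: partial_deriv_def vector_derivative_works)
    from has_vector_derivative_mult[OF
        has_vector_derivative_of_real[OF has_real_derivative_mi_power[of x i \<alpha>]] this]
    show "((\<lambda>t. of_real (mi_power (x + t *\<^sub>R axis i 1) \<alpha>) * g (x + t *\<^sub>R axis i 1))
        has_vector_derivative ?D x) (at 0)"
      by (simp add: mult_ac)
  qed
  with int1 int2 show ?thesis
    by (simp add: eq_neg_iff_add_eq_0)
qed

text \<open>
  Iterated integration by parts moves \<open>\<partial>\<^sup>\<beta>\<close> onto \<open>x\<^sup>\<alpha>\<close>, and \<open>\<partial>\<^sup>\<beta> x\<^sup>\<alpha> / \<alpha>! = x\<^bsup>\<alpha>-\<beta>\<^esup> / (\<alpha> - \<beta>)!\<close> if \<open>\<beta> \<le> \<alpha>\<close>,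
  while it is \<open>0\<close> otherwise.
\<close>

lemma normalised_moment_mi_deriv:
  fixes g :: "real ^ 'n::finite \<Rightarrow> complex"
  assumes g: "C_times m g"
    and int: "\<And>\<alpha> \<beta>. mi_abs \<alpha> \<le> m \<Longrightarrow> mi_abs \<beta> \<le> m \<Longrightarrow>
      integrable lborel (\<lambda>x. of_real (mi_power x \<alpha>) * mi_deriv \<beta> g x)"
  shows "mi_abs \<alpha> \<le> m \<Longrightarrow> mi_abs \<beta> \<le> m \<Longrightarrow>
    (LINT x|lborel. of_real (mi_power x \<alpha>) * mi_deriv \<beta> g x) / of_nat (mi_fact \<alpha>)
    = (if \<beta> \<le> \<alpha> then (- 1) ^ mi_abs \<beta> *
        ((LINT x|lborel. of_real (mi_power x (\<alpha> - \<beta>)) * g x) / of_nat (mi_fact (\<alpha> - \<beta>))) else 0)"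
proof (induction \<beta> arbitrary: \<alpha> rule: mi_induct)
  case zero
  then show ?case
    by (simp add: mi_zero_le mi_diff_zero mi_deriv_zero mi_abs_zero)
next
  case (inc i \<beta>)
  let ?\<alpha> = "\<alpha>(i := \<alpha> i - 1)"
  have \<beta>: "mi_abs \<beta> < m"
    using inc.prems by (simp add: mi_abs_inc)
  have deriv: "mi_deriv (mi_inc i \<beta>) g = partial_deriv i (mi_deriv \<beta> g)"
    by (rule outermostD[OF inc.hyps order_refl])
  have "(LINT x|lborel. of_real (mi_power x \<alpha>) * mi_deriv (mi_inc i \<beta>) g x)
    = - of_nat (\<alpha> i) * (LINT x|lborel. of_real (mi_power x ?\<alpha>) * mi_deriv \<beta> g x)"
    unfolding deriv
  proof (rule integral_mi_power_partial_deriv[where m = m])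
    show "C_times (Suc (m - Suc (mi_abs \<beta>))) (mi_deriv \<beta> g)"
      using C_times_mi_deriv[OF g, of \<beta>] \<beta> by (simp add: Suc_diff_Suc)
  qed (use inc.prems \<beta> int in \<open>auto simp flip: deriv\<close>)
  note parts = this
  show ?case
  proof (cases "\<alpha> i")
    case 0
    then have "\<not> mi_inc i \<beta> \<le> \<alpha>"
      by (auto simp: le_fun_def mi_inc_apply intro!: exI[of _ i])
    with 0 parts show ?thesis
      by simp
  next
    case (Suc k)
    then have \<alpha>: "\<alpha> = mi_inc i ?\<alpha>"
      by (auto simp: fun_eq_iff mi_inc_apply)
    have le: "mi_inc i \<beta> \<le> \<alpha> \<longleftrightarrow> \<beta> \<le> ?\<alpha>"
      using Suc by (auto simp: le_fun_def mi_inc_apply)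
    have diff: "\<alpha> - mi_inc i \<beta> = ?\<alpha> - \<beta>"
      by (subst \<alpha>) (rule mi_inc_diff_mi_inc)
    have fact: "mi_fact \<alpha> = \<alpha> i * mi_fact ?\<alpha>"
      using Suc by (subst \<alpha>) (simp add: mi_fact_inc)
    have "mi_abs ?\<alpha> \<le> m"
      using inc.prems(1) \<alpha> mi_abs_inc[of i ?\<alpha>] by simp
    note IH = inc.IH[OF this less_imp_le[OF \<beta>]]
    have "(LINT x|lborel. of_real (mi_power x \<alpha>) * mi_deriv (mi_inc i \<beta>) g x) / of_nat (mi_fact \<alpha>)
      = - ((LINT x|lborel. of_real (mi_power x ?\<alpha>) * mi_deriv \<beta> g x) / of_nat (mi_fact ?\<alpha>))"
      unfolding parts fact of_nat_mult using Suc by (simp del: of_nat_Suc)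
    then show ?thesis
      unfolding IH le diff mi_abs_inc
      by (cases "\<beta> \<le> ?\<alpha>")
         (simp_all only: if_True if_False power_Suc mult_minus1 mult_1_left mult_minus_left minus_zero)
  qed
qed

section \<open>The moments of the function \<open>H_fun\<close>\<close>

text \<open>
  The inner sum in \<open>H_fun\<close> is a convolution: passing from \<open>2\<pi>\<i>\<close> to \<open>-2\<pi>\<i>\<close> contributes the sign
  \<open>(-1)\<^bsup>|\<beta> - \<alpha>|\<^esup>\<close>, which combines with \<open>(-1)\<^bsup>|\<alpha>|\<^esup>\<close> to a sign that depends on \<open>\<beta>\<close> only.
\<close>

lemma mi_conv_H_coeffs:
  fixes b :: "'n::finite multi_index \<Rightarrow> real" and G :: "real ^ 'n \<Rightarrow> complex"
  shows "(\<Sum>\<alpha>\<in>{\<alpha>. \<alpha> \<le> \<beta>}. of_real (b \<alpha>) * (- 1) ^ mi_abs \<alpha> *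
      (mi_deriv (\<beta> - \<alpha>) G 0
        / (of_nat (mi_fact (\<beta> - \<alpha>)) * (2 * of_real pi * \<i>) ^ mi_abs (\<beta> - \<alpha>))))
    = (- 1) ^ mi_abs \<beta> * mi_conv (\<lambda>\<alpha>. of_real (b \<alpha>))
        (\<lambda>\<gamma>. taylor_coeff G 0 \<gamma> / (- 2 * of_real pi * \<i>) ^ mi_abs \<gamma>) \<beta>"
  unfolding mi_conv_def sum_distrib_left
proof (rule sum.cong[OF refl])
  fix \<alpha>
  assume "\<alpha> \<in> {\<alpha>. \<alpha> \<le> \<beta>}"
  then have abs: "mi_abs \<beta> = mi_abs \<alpha> + mi_abs (\<beta> - \<alpha>)"
    using mi_abs_diff[of \<alpha> \<beta>] by simp
  have "(- 2 * of_real pi * \<i>) ^ mi_abs (\<beta> - \<alpha>)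
      = ((- 1) ^ mi_abs (\<beta> - \<alpha>) * (2 * of_real pi * \<i>) ^ mi_abs (\<beta> - \<alpha>) :: complex)"
    by (simp flip: power_mult_distrib)
  then show "of_real (b \<alpha>) * (- 1) ^ mi_abs \<alpha> * (mi_deriv (\<beta> - \<alpha>) G 0
        / (of_nat (mi_fact (\<beta> - \<alpha>)) * (2 * of_real pi * \<i>) ^ mi_abs (\<beta> - \<alpha>)))
      = (- 1) ^ mi_abs \<beta> * (of_real (b \<alpha>) * (taylor_coeff G 0 (\<beta> - \<alpha>)
        / (- 2 * of_real pi * \<i>) ^ mi_abs (\<beta> - \<alpha>)))"
    unfolding abs power_add taylor_coeff_def
    by (cases "even (mi_abs (\<beta> - \<alpha>))") (simp_all add: mult_ac)
qed

lemma mi_conv_rescale: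
  fixes f g :: "'n::finite multi_index \<Rightarrow> complex"
  assumes "c \<noteq> 0"
  shows "mi_conv (\<lambda>\<gamma>. f \<gamma> / c ^ mi_abs \<gamma>) (\<lambda>\<gamma>. g \<gamma> / c ^ mi_abs \<gamma>) \<beta> = mi_conv f g \<beta> / c ^ mi_abs \<beta>"
  unfolding mi_conv_def sum_divide_distrib
proof (rule sum.cong[OF refl])
  fix \<alpha>
  assume "\<alpha> \<in> {\<alpha>. \<alpha> \<le> \<beta>}"
  then have "mi_abs \<beta> = mi_abs \<alpha> + mi_abs (\<beta> - \<alpha>)"
    using mi_abs_diff[of \<alpha> \<beta>] by simp
  then show "f \<alpha> / c ^ mi_abs \<alpha> * (g (\<beta> - \<alpha>) / c ^ mi_abs (\<beta> - \<alpha>))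
      = f \<alpha> * g (\<beta> - \<alpha>) / c ^ mi_abs \<beta>"
    by (simp add: power_add)
qed

text \<open>
  The sign \<open>(-1)\<^bsup>|\<beta>|\<^esup>\<close> in the coefficient of \<open>\<partial>\<^sup>\<beta>\<eta>\<close> cancels the one from integration by parts, so the
  sequence of normalised moments is \<open>(b * d) * E = b * (d * E) = b\<close>.
\<close>

lemma normalised_moment_H_fun:
  fixes a :: "'n::finite multi_index \<Rightarrow> real" and \<eta> :: "real ^ 'n \<Rightarrow> complex"
  assumes \<eta>: "C_times (N - 1) \<eta>"
    and int: "\<And>\<alpha> \<beta>. mi_abs \<alpha> \<le> N - 1 \<Longrightarrow> mi_abs \<beta> \<le> N - 1 \<Longrightarrow>
      integrable lborel (\<lambda>x. of_real (mi_power x \<alpha>) * mi_deriv \<beta> \<eta> x)"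
    and nz: "fourier \<eta> 0 \<noteq> 0" and \<alpha>: "mi_abs \<alpha> \<le> N - 1"
  shows "integrable lborel (\<lambda>x. of_real (mi_power x \<alpha>) * H_fun N a \<eta> x)" (is ?int)
    and "(LINT x|lborel. of_real (mi_power x \<alpha>) * H_fun N a \<eta> x) / of_nat (mi_fact \<alpha>)
      = of_real (matrix_inv_on (multi_indices (N - 1)) (tri_matrix a) (\<lambda>_. 0) \<alpha>)" (is ?moment)
proof -
  define b where "b = matrix_inv_on (multi_indices (N - 1)) (tri_matrix a) (\<lambda>_. 0)"
  define c where "c = - 2 * complex_of_real pi * \<i>"
  define E where "E \<gamma> = (LINT x|lborel. of_real (mi_power x \<gamma>) * \<eta> x) / of_nat (mi_fact \<gamma>)" for \<gamma>
  define d where "d \<gamma> = taylor_coeff (\<lambda>\<xi>. 1 / fourier \<eta> \<xi>) 0 \<gamma> / c ^ mi_abs \<gamma>" for \<gamma>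
  define p where "p \<beta> = (- 1) ^ mi_abs \<beta> * mi_conv (\<lambda>\<alpha>. of_real (b \<alpha>)) d \<beta>" for \<beta>
  let ?I = "multi_indices (N - 1) :: 'n multi_index set"
  have c: "c \<noteq> 0"
    by (simp add: c_def)
  have int\<eta>: "integrable lborel (\<lambda>x. of_real (mi_power x \<gamma>) * \<eta> x)" if "mi_abs \<gamma> \<le> N - 1" for \<gamma>
    using int[OF that, of "\<lambda>_. 0"] by (simp add: mi_abs_zero mi_deriv_zero)
  have H: "H_fun N a \<eta> x = (\<Sum>\<beta>\<in>?I. p \<beta> * mi_deriv \<beta> \<eta> x)" for x
    unfolding H_fun_def p_def d_def c_def mi_conv_H_coeffs[symmetric] sum_distrib_right b_def ..
  have H': "of_real (mi_power x \<alpha>) * H_fun N a \<eta> x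
      = (\<Sum>\<beta>\<in>?I. p \<beta> * (of_real (mi_power x \<alpha>) * mi_deriv \<beta> \<eta> x))" for x
    unfolding H sum_distrib_left by (simp add: mult_ac)
  have intI: "integrable lborel (\<lambda>x. p \<beta> * (of_real (mi_power x \<alpha>) * mi_deriv \<beta> \<eta> x))"
    if "\<beta> \<in> ?I" for \<beta>
    using that int[OF \<alpha>] by (intro integrable_mult_right) (auto simp: multi_indices_def)
  then show ?int
    unfolding H' by (rule Bochner_Integration.integrable_sum)
  have dE: "mi_conv d E \<beta> = of_bool (\<beta> = (\<lambda>_. 0))" if \<beta>: "mi_abs \<beta> \<le> N - 1" for \<beta>
  proof -
    \<comment> \<open>The Fourier transform may vanish away from the origin; derivatives at the origin only see \<open>?U\<close>.\<close>
    let ?U = "{\<xi>. fourier \<eta> \<xi> \<noteq> 0}"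
    have "integrable lborel \<eta>"
      using int\<eta>[of "\<lambda>_. 0"] by (simp add: mi_power_zero mi_abs_zero)
    then have "open ?U"
      by (intro open_Collect_neq continuous_on_fourier continuous_on_const)
    moreover have "partially_differentiable_on (N - 1) ?U (fourier \<eta>)"
      using partially_differentiable_on_fourier[OF int\<eta>]
      by (rule partially_differentiable_on_subset) auto
    ultimately have inv: "mi_conv (taylor_coeff (\<lambda>\<xi>. 1 / fourier \<eta> \<xi>) 0) (taylor_coeff (fourier \<eta>) 0) \<beta>
        = of_bool (\<beta> = (\<lambda>_. 0))"
      using \<beta> nz by (intro mi_conv_taylor_coeff_inverse) auto
    have "mi_conv d E \<beta> = mi_conv d (\<lambda>\<gamma>. taylor_coeff (fourier \<eta>) 0 \<gamma> / c ^ mi_abs \<gamma>) \<beta>"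
    proof (rule mi_conv_cong[OF refl])
      fix \<gamma>
      assume "\<gamma> \<le> \<beta>"
      then have "mi_abs \<gamma> \<le> N - 1"
        using mi_abs_mono \<beta> by (meson order_trans)
      then have "taylor_coeff (fourier \<eta>) 0 \<gamma> = c ^ mi_abs \<gamma> * E \<gamma>"
        unfolding c_def E_def by (intro taylor_coeff_fourier[OF int\<eta>])
      with c show "E \<gamma> = taylor_coeff (fourier \<eta>) 0 \<gamma> / c ^ mi_abs \<gamma>"
        by simp
    qed
    also have "\<dots> = of_bool (\<beta> = (\<lambda>_. 0))"
      using inv unfolding d_def mi_conv_rescale[OF c] by (simp add: mi_abs_zero)
    finally show ?thesis .
  qed
  have "(LINT x|lborel. of_real (mi_power x \<alpha>) * H_fun N a \<eta> x) / of_nat (mi_fact \<alpha>)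
      = (\<Sum>\<beta>\<in>?I. p \<beta> * ((LINT x|lborel. of_real (mi_power x \<alpha>) * mi_deriv \<beta> \<eta> x) / of_nat (mi_fact \<alpha>)))"
    unfolding H' using intI by (simp add: sum_divide_distrib)
  also have "\<dots> = (\<Sum>\<beta>\<in>?I. if \<beta> \<le> \<alpha> then mi_conv (\<lambda>\<alpha>. of_real (b \<alpha>)) d \<beta> * E (\<alpha> - \<beta>) else 0)"
  proof (rule sum.cong[OF refl])
    fix \<beta>
    assume "\<beta> \<in> ?I"
    then have "mi_abs \<beta> \<le> N - 1"
      by (simp add: multi_indices_def)
    from normalised_moment_mi_deriv[OF \<eta> int \<alpha> this]
    show "p \<beta> * ((LINT x|lborel. of_real (mi_power x \<alpha>) * mi_deriv \<beta> \<eta> x) / of_nat (mi_fact \<alpha>))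
        = (if \<beta> \<le> \<alpha> then mi_conv (\<lambda>\<alpha>. of_real (b \<alpha>)) d \<beta> * E (\<alpha> - \<beta>) else 0)"
      by (simp add: p_def E_def flip: power_add)
  qed
  also have "\<dots> = mi_conv (mi_conv (\<lambda>\<alpha>. of_real (b \<alpha>)) d) E \<alpha>"
    unfolding mi_conv_def[of "mi_conv _ _"]
    by (rule sum.mono_neutral_cong_right[OF finite_multi_indices])
       (use \<alpha> in \<open>auto simp: multi_indices_def dest: mi_abs_mono\<close>)
  also have "\<dots> = mi_conv (\<lambda>\<alpha>. of_real (b \<alpha>)) (\<lambda>\<beta>. of_bool (\<beta> = (\<lambda>_. 0))) \<alpha>"
    unfolding mi_conv_assoc
    using \<alpha> by (intro mi_conv_cong refl dE) (meson mi_abs_mono order_trans)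
  also have "\<dots> = of_real (b \<alpha>)"
    by (rule mi_conv_unit)
  finally show ?moment
    by (simp add: b_def)
qed

theorem theorem3p1:
  fixes N :: nat
    and a :: "'n::finite multi_index \<Rightarrow> real"
    and \<eta> :: "real ^ 'n \<Rightarrow> complex"
    and A K :: real
  assumes "N \<ge> 1"
    and "a (\<lambda>_. 0) = 1"
    and "C_times (N - 1) \<eta>"
    and "K > real N + real CARD('n)"
    and "\<And>x. norm (\<eta> x) \<le> A * (1 + norm x) powr (- K)"
    and "\<And>\<alpha>. mi_abs \<alpha> \<le> N - 1 \<Longrightarrow>
           integrable lborel (\<lambda>x. norm x ^ (N - 1) * norm (mi_deriv \<alpha> \<eta> x))"
    and "fourier \<eta> 0 \<noteq> 0"
  shows "(\<forall>\<alpha>. mi_abs \<alpha> \<le> N - 1 \<longrightarrow>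
            integrable lborel (\<lambda>x. of_real (mi_power x \<alpha>) * H_fun N a \<eta> x)) \<and>
         (LINT x|lborel. H_fun N a \<eta> x) = 1 \<and>
         (\<forall>\<beta>. 1 \<le> mi_abs \<beta> \<and> mi_abs \<beta> \<le> N - 1 \<longrightarrow>
            (\<Sum>\<alpha>\<in>{\<alpha>. \<alpha> \<le> \<beta>}. of_real (a (\<beta> - \<alpha>)) / of_nat (mi_fact \<alpha>)
               * (LINT x|lborel. of_real (mi_power x \<alpha>) * H_fun N a \<eta> x)) = 0)"
proof -
  let ?b = "matrix_inv_on (multi_indices (N - 1)) (tri_matrix a) (\<lambda>_. 0)"
  let ?M = "\<lambda>\<alpha>. LINT x|lborel. of_real (mi_power x \<alpha>) * H_fun N a \<eta> x"
  have int: "integrable lborel (\<lambda>x. of_real (mi_power x \<alpha>) * mi_deriv \<beta> \<eta> x)"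
    if "mi_abs \<alpha> \<le> N - 1" "mi_abs \<beta> \<le> N - 1" for \<alpha> \<beta>
    using C_times_imp_continuous_on[OF C_times_mi_deriv[OF assms(3) that(2)]] assms(6)[OF that(2)] that(1)
    by (rule integrable_mi_power_mult)
  have H: "integrable lborel (\<lambda>x. of_real (mi_power x \<alpha>) * H_fun N a \<eta> x)"
    "?M \<alpha> / of_nat (mi_fact \<alpha>) = of_real (?b \<alpha>)" if "mi_abs \<alpha> \<le> N - 1" for \<alpha>
    by (intro normalised_moment_H_fun[OF assms(3) int assms(7)] that; assumption)+
  have sum: "(\<Sum>\<alpha>\<in>{\<alpha>. \<alpha> \<le> \<beta>}. of_real (a (\<beta> - \<alpha>)) / of_nat (mi_fact \<alpha>) * ?M \<alpha>)
      = of_bool (\<beta> = (\<lambda>_. 0))" if \<beta>: "mi_abs \<beta> \<le> N - 1" for \<beta>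
  proof -
    have "(\<Sum>\<alpha>\<in>{\<alpha>. \<alpha> \<le> \<beta>}. of_real (a (\<beta> - \<alpha>)) / of_nat (mi_fact \<alpha>) * ?M \<alpha>)
        = (\<Sum>\<alpha>\<in>{\<alpha>. \<alpha> \<le> \<beta>}. of_real (?b \<alpha> * a (\<beta> - \<alpha>)))"
    proof (rule sum.cong[OF refl])
      fix \<alpha>
      assume "\<alpha> \<in> {\<alpha>. \<alpha> \<le> \<beta>}"
      then have "mi_abs \<alpha> \<le> N - 1"
        using \<beta> mi_abs_mono[of \<alpha> \<beta>] by simp
      from H(2)[OF this]
      show "of_real (a (\<beta> - \<alpha>)) / of_nat (mi_fact \<alpha>) * ?M \<alpha> = of_real (?b \<alpha> * a (\<beta> - \<alpha>))"
        by (simp add: mult.commute flip: times_divide_eq_right)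
    qed
    also have "\<dots> = of_real (mi_conv ?b a \<beta>)"
      by (simp add: mi_conv_def)
    also have "\<dots> = of_bool (\<beta> = (\<lambda>_. 0))"
      unfolding mi_conv_matrix_inv_on_tri_matrix[of a, OF assms(2) \<beta>] by simp
    finally show ?thesis .
  qed
  have "(LINT x|lborel. H_fun N a \<eta> x) = 1"
    using sum[of "\<lambda>_. 0"] assms(2)
    by (simp add: mi_abs_zero mi_le_zero mi_diff_self mi_fact_zero mi_power_zero)
  moreover have "(\<Sum>\<alpha>\<in>{\<alpha>. \<alpha> \<le> \<beta>}. of_real (a (\<beta> - \<alpha>)) / of_nat (mi_fact \<alpha>) * ?M \<alpha>) = 0"
    if "1 \<le> mi_abs \<beta>" "mi_abs \<beta> \<le> N - 1" for \<beta>
  proof -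
    have "\<beta> \<noteq> (\<lambda>_. 0)"
      using that(1) by (auto simp: mi_abs_zero)
    then show ?thesis
      using sum[OF that(2)] by simp
  qed
  ultimately show ?thesis
    using H(1) by blast
qed

end
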